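(* Let $a\in \{2, 3, 4, 5\}$. Then the following are true. (i) If $\ell \in \{2, 3, 5, 7\}$ and $p$ is a prime with $p\equiv -1\pmod{\ell^{\mathrm{ord}_\ell(N_{a})+1}}$, then for every positive integer $n$ coprime to $p$, $$MO(a;pn)\equiv 0\pmod{\ell}.$$ (ii) If $\ell\geq 11$ is prime and $p$ is a prime with $p\equiv-1\pmod{\ell}$, then for every positive integer $n$ coprime to $p$, $$MO(a;pn)\equiv 0\pmod{\ell}.$$
   Context: For a positive integer $a$, the integers $MO(a;n)$ are the coefficients of the formal power series $$\sum_{n\geq0}MO(a;n)\,q^n:=\sum_{0< k_1<k_2<\cdots<k_a} \frac{q^{k_1+k_2+\cdots+k_a}}{(1-q^{k_1})^2(1-q^{k_2})^2\cdots(1-q^{k_a})^2}.$$ The integers $N_a$ are $$N_2:=2^3,\qquad N_3:=2^{7}\cdot 3\cdot 5,\qquad N_4:=2^{10}\cdot 3^{3}\cdot 5\cdot 7,\qquad N_5:=2^{15}\cdot 3^{3}\cdot 5^2\cdot 7,$$ and $\mathrm{ord}_\ell(N)$ is the exponent of the prime $\ell$ in the factorization of $N$. *)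

theory Defs
  imports "HOL-Analysis.Infinite_Sum" "HOL-Computational_Algebra.Computational_Algebra"
    "HOL-Number_Theory.Cong"
begin

definition MO_index :: "nat \<Rightarrow> nat list set" where
  "MO_index a = {ks. length ks = a \<and> sorted_wrt (<) ks \<and> (\<forall>k\<in>set ks. 0 < k)}"

text \<open>
  Everything takes place in \<open>\<int>[[q]]\<close> with \<open>q = fps_X\<close>. Division of power series is only available
  over coefficient types with an inverse operation, hence \<^const>\<open>fps_right_inverse\<close>, whose last
  argument is the constant term of the inverse.
\<close>

definition MO_term :: "nat list \<Rightarrow> int fps" where
  "MO_term ks = fps_X ^ sum_list ks *
     fps_right_inverse (\<Prod>i<length ks. (1 - fps_X ^ (ks ! i))\<^sup>2) 1"

text \<open>The infinite sum is taken in the \<open>q\<close>-adic topology of formal power series.\<close>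

definition MO_series :: "nat \<Rightarrow> int fps" where
  "MO_series a = (\<Sum>\<^sub>\<infinity>ks\<in>MO_index a. MO_term ks)"

definition MO :: "nat \<Rightarrow> nat \<Rightarrow> int" where
  "MO a n = fps_nth (MO_series a) n"

definition N :: "nat \<Rightarrow> nat" where
  "N a = (if a = 2 then 2 ^ 3
          else if a = 3 then 2 ^ 7 * 3 * 5
          else if a = 4 then 2 ^ 10 * 3 ^ 3 * 5 * 7
          else if a = 5 then 2 ^ 15 * 3 ^ 3 * 5 ^ 2 * 7
          else undefined)"

text \<open>
  The next two facts show that the inverse and the infinite sum above are genuine, i.e. that
  neither takes a default value.
\<close>

lemma MO_term_mult:
  assumes "ks \<in> MO_index a"
  shows "MO_term ks * (\<Prod>i<a. (1 - fps_X ^ (ks ! i))\<^sup>2) = fps_X ^ sum_list ks"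
proof -
  let ?d = "\<Prod>i<length ks. (1 - fps_X ^ (ks ! i))\<^sup>2 :: int fps"
  have "fps_nth ((1 - fps_X ^ (ks ! i))\<^sup>2 :: int fps) 0 = 1" if "i < length ks" for i
  proof -
    have "ks ! i > 0"
      using assms that by (auto simp: MO_index_def)
    then show ?thesis
      by (simp add: fps_power_zeroth zero_power)
  qed
  moreover have "fps_nth (prod f S) 0 = (\<Prod>x\<in>S. fps_nth (f x) 0)" for f :: "nat \<Rightarrow> int fps" and S
    by (induction S rule: infinite_finite_induct) simp_all
  ultimately have "fps_nth ?d 0 * 1 = 1"
    by simp
  from fps_right_inverse[OF this] have "?d * fps_right_inverse ?d 1 = 1" .
  moreover have "length ks = a"
    using assms by (simp add: MO_index_def)
  ultimately show ?thesis
    by (simp add: MO_term_def mult.assoc mult.commute[of "fps_right_inverse _ _"])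
qed

lemma MO_has_sum: "(MO_term has_sum MO_series a) (MO_index a)"
proof -
  define B where "B n = {ks \<in> MO_index a. sum_list ks \<le> n}" for n
  define G where "G = Abs_fps (\<lambda>n. fps_nth (sum MO_term (B n)) n)"
  have fin: "finite (B n)" for n
  proof (rule finite_subset)
    show "B n \<subseteq> {ks. set ks \<subseteq> {..n} \<and> length ks = a}"
      using member_le_sum_list by (fastforce simp: B_def MO_index_def)
    show "finite {ks. set ks \<subseteq> {..n} \<and> length ks = a}"
      by (rule finite_lists_length_eq) simp
  qed
  have "(MO_term has_sum G) (MO_index a)"
    unfolding has_sum_def
  proof (rule tendsto_fpsI)
    fix n
    have "fps_nth (sum MO_term F) n = fps_nth G n"
      if F: "finite F" "B n \<subseteq> F" "F \<subseteq> MO_index a" for F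
    proof -
      have "(\<Sum>ks\<in>B n. fps_nth (MO_term ks) n) = (\<Sum>ks\<in>F. fps_nth (MO_term ks) n)"
      proof (rule sum.mono_neutral_left)
        show "\<forall>ks\<in>F - B n. fps_nth (MO_term ks) n = 0"
        proof
          fix ks assume "ks \<in> F - B n"
          with F have "n < sum_list ks"
            by (auto simp: B_def)
          then show "fps_nth (MO_term ks) n = 0"
            by (simp add: MO_term_def fps_X_power_mult_nth)
        qed
      qed (use F in auto)
      then show ?thesis
        by (simp add: G_def fps_sum_nth)
    qed
    moreover have "B n \<subseteq> MO_index a"
      by (auto simp: B_def)
    ultimately show "eventually (\<lambda>F. fps_nth (sum MO_term F) n = fps_nth G n)
                       (finite_subsets_at_top (MO_index a))"
      unfolding eventually_finite_subsets_at_top using fin by blast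
  qed
  then have "MO_term summable_on MO_index a"
    by (auto simp: summable_on_def)
  then show ?thesis
    unfolding MO_series_def by (rule has_sum_infsum)
qed

end

theory Submission
  imports Defs
begin

text \<open>
  In terms of the series \<open>u\<^sub>k = q\<^sup>k / (1 - q\<^sup>k)\<^sup>2\<close>, the generating function of \<open>MO(a; n)\<close> is the
  elementary symmetric function \<open>e\<^sub>a(u\<^sub>1, u\<^sub>2, \<dots>)\<close>, while the power sums of the \<open>u\<^sub>k\<close> are linear
  combinations of the series \<open>\<Sum> \<sigma>\<^sub>j(n) q\<^sup>n\<close> with odd \<open>j\<close>. By Newton's identities \<open>e\<^sub>a\<close> is
  quasimodular of weight at most \<open>2 a \<le> 10\<close>, where there are no cusp forms, so that \<open>N\<^sub>a MO(a; n)\<close>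
  is an integral combination of the terms \<open>n\<^sup>i \<sigma>\<^sub>j(n)\<close> with odd \<open>j\<close>. Since \<open>\<sigma>\<^sub>j(p n) = (1 + p\<^sup>j)
  \<sigma>\<^sub>j(n)\<close> and \<open>p \<equiv> -1\<close>, it follows that \<open>N\<^sub>a MO(a; p n)\<close> vanishes to one more power of the prime \<open>\<ell>\<close>
  than \<open>N\<^sub>a\<close> does. The Ramanujan identities for the Eisenstein series that make the combination
  explicit come from an elementary argument of Skoruppa, a summation over the solutions of \<open>a x +
  b y = n\<close>.
\<close>

subsection \<open>Convolutions of divisor sums\<close>

text \<open>The Lambert series \<Sum> f(d) q^d / (1 - q^d). The condition \<open>0 < n\<close> makes
  the constant coefficient an empty sum, as every \<open>d\<close> divides 0.\<close>

definition divisor_fps :: "(nat \<Rightarrow> 'a::comm_ring_1) \<Rightarrow> 'a fps" where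
  "divisor_fps f = Abs_fps (\<lambda>n. \<Sum>d | d dvd n \<and> 0 < n. f d)"

definition quads :: "nat \<Rightarrow> (nat \<times> nat \<times> nat \<times> nat) set" where
  "quads n = {(a, b, x, y). 0 < a \<and> 0 < b \<and> 0 < x \<and> 0 < y \<and> a * x + b * y = n}"

lemma finite_quads [simp]: "finite (quads n)"
proof (rule finite_subset)
  show "quads n \<subseteq> {..n} \<times> {..n} \<times> {..n} \<times> {..n}"
  proof (clarsimp simp: quads_def)
    fix a b x y :: nat
    assume "0 < a" "0 < b" "0 < x" "0 < y"
    then have "a \<le> a * x" "x \<le> a * x" "b \<le> b * y" "y \<le> b * y" by auto
    then show "a \<le> a * x + b * y \<and> b \<le> a * x + b * y \<and> x \<le> a * x + b * y \<and> y \<le> a * x + b * y"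
      by linarith
  qed
qed simp

text \<open>The coefficient ranges over i + j = n with a divisor \<open>a\<close> of i and a divisor
  \<open>b\<close> of j; recording the cofactors x = i / a and y = j / b turns this into a sum over
  \<open>quads n\<close>.\<close>

lemma divisor_fps_mult_nth:
  "(divisor_fps f * divisor_fps g) $ n = (\<Sum>(a, b, x, y)\<in>quads n. f a * g b)"
proof -
  define V where "V i = {d::nat. d dvd i \<and> 0 < i}" for i
  have fin: "finite (V i)" for i
    by (cases "i = 0") (auto simp: V_def)
  have "(divisor_fps f * divisor_fps g) $ n = (\<Sum>i=0..n. \<Sum>(a, b)\<in>V i \<times> V (n - i). f a * g b)"
    by (simp add: fps_mult_nth divisor_fps_def V_def sum_product sum.cartesian_product)
  also have "\<dots> = (\<Sum>(i, a, b)\<in>(SIGMA i:{0..n}. V i \<times> V (n - i)). f a * g b)"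
    using fin by (subst sum.Sigma) (auto simp: case_prod_unfold)
  also have "\<dots> = (\<Sum>(a, b, x, y)\<in>quads n. f a * g b)"
  proof (rule sum.reindex_bij_witness)
    fix t assume "t \<in> (SIGMA i:{0..n}. V i \<times> V (n - i))"
    then obtain i a b where t: "t = (i, a, b)" "i \<le> n" "a dvd i" "b dvd n - i" "0 < i" "i < n"
      by (auto simp: V_def)
    from t(3,4) obtain x y where xy: "i = a * x" "n - i = b * y"
      unfolding dvd_def by blast
    with t have pos: "0 < a" "0 < x" "0 < b" "0 < y" by (auto intro!: Nat.gr0I)
    have n: "n = a * x + b * y" using xy t by linarith
    let ?j = "\<lambda>(i, a, b). (a, b, i div a, (n - i) div b)"
    let ?i = "\<lambda>(a, b, x, y). (a * x, a, b)"
    show "?i (?j t) = t" "?j t \<in> quads n"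
      "(case ?j t of (a, b, x, y) \<Rightarrow> f a * g b) = (case t of (i, a, b) \<Rightarrow> f a * g b)"
      using t xy pos n by (auto simp: quads_def)
  next
    fix t assume "t \<in> quads n"
    then show "(\<lambda>(i, a, b). (a, b, i div a, (n - i) div b)) ((\<lambda>(a, b, x, y). (a * x, a, b)) t) = t"
      "(\<lambda>(a, b, x, y). (a * x, a, b)) t \<in> (SIGMA i:{0..n}. V i \<times> V (n - i))"
      by (auto simp: quads_def V_def)
  qed
  finally show ?thesis .
qed

text \<open>
  The shift \<open>(a, b, x, y) \<mapsto> (a, a + b, x - y, y)\<close> preserves \<open>a x + b y\<close> and maps the solutions
  with \<open>x > y\<close> bijectively to those with \<open>a < b\<close>. The symmetries of \<open>F\<close> make everything off the
  two diagonals cancel.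
\<close>

lemma quads_sum_shift:
  fixes F :: "nat \<Rightarrow> nat \<Rightarrow> 'a::comm_ring_1"
  assumes sym: "\<And>a b. F a b = F b a"
    and shift: "\<And>a b. F a (a + b) = F b (a + b)"
    and "0 < n"
  shows "(\<Sum>(a, b, x, y)\<in>quads n. F a b - F a (a + b)) =
         (\<Sum>d | d dvd n. of_nat (n div d - 1) * F d d - (\<Sum>a\<in>{0<..<d}. F a d))"
proof -
  define T where "T P = {t \<in> quads n. P t}" for P
  let ?f = "\<lambda>(a, b, x, y). F a b" and ?g = "\<lambda>(a, b, x, y). F a (a + b)"
  have fin: "finite (T P)" for P by (simp add: T_def)
  have split: "sum h (quads n) = sum h (T P) + sum h (T Q) + sum h (T R)"
    if "\<And>t. t \<in> quads n \<Longrightarrow> P t \<or> Q t \<or> R t"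
      "\<And>t. \<not> (P t \<and> Q t)" "\<And>t. \<not> (P t \<and> R t)" "\<And>t. \<not> (Q t \<and> R t)"
    for h :: "_ \<Rightarrow> 'a" and P Q R
  proof -
    have "quads n = (T P \<union> T Q) \<union> T R" using that by (auto simp: T_def)
    moreover have "sum h ((T P \<union> T Q) \<union> T R) = sum h (T P \<union> T Q) + sum h (T R)"
      by (rule sum.union_disjoint) (use fin that in \<open>auto simp: T_def\<close>)
    moreover have "sum h (T P \<union> T Q) = sum h (T P) + sum h (T Q)"
      by (rule sum.union_disjoint) (use fin that in \<open>auto simp: T_def\<close>)
    ultimately show ?thesis by simp
  qed
  \<comment> \<open>The two sums are split by different trichotomies, \<open>a\<close> against
    \<open>b\<close> for \<open>F a b\<close> and \<open>x\<close> against \<open>y\<close> for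
    \<open>F a (a + b)\<close>, because the shift turns \<open>x > y\<close> into
    \<open>a < b\<close>.\<close>
  have f_split: "sum ?f (quads n) = sum ?f (T (\<lambda>(a, b, x, y). a < b)) +
      sum ?f (T (\<lambda>(a, b, x, y). a > b)) + sum ?f (T (\<lambda>(a, b, x, y). a = b))"
    by (rule split) (auto)
  have g_split: "sum ?g (quads n) = sum ?g (T (\<lambda>(a, b, x, y). x > y)) +
      sum ?g (T (\<lambda>(a, b, x, y). x < y)) + sum ?g (T (\<lambda>(a, b, x, y). x = y))"
    by (rule split) (auto)
  have f_swap: "sum ?f (T (\<lambda>(a, b, x, y). a > b)) = sum ?f (T (\<lambda>(a, b, x, y). a < b))"
    by (rule sum.reindex_bij_witness[of _ "\<lambda>(a, b, x, y). (b, a, y, x)"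
        "\<lambda>(a, b, x, y). (b, a, y, x)"])
      (auto simp: T_def quads_def sym)
  have g_swap: "sum ?g (T (\<lambda>(a, b, x, y). x < y)) = sum ?g (T (\<lambda>(a, b, x, y). x > y))"
    by (rule sum.reindex_bij_witness[of _ "\<lambda>(a, b, x, y). (b, a, y, x)"
        "\<lambda>(a, b, x, y). (b, a, y, x)"])
      (auto simp: T_def quads_def add.commute intro: shift[symmetric])
  have shifted: "sum ?f (T (\<lambda>(a, b, x, y). a < b)) = sum ?g (T (\<lambda>(a, b, x, y). x > y))"
    by (rule sum.reindex_bij_witness[of _ "\<lambda>(a, b, x, y). (a, a + b, x - y, y)"
          "\<lambda>(a, b, x, y). (a, b - a, x + y, y)"])
      (auto simp: T_def quads_def algebra_simps dest!: less_imp_Suc_add)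
  \<comment> \<open>With a = b = d the equation becomes d (x + y) = n, which has n/d - 1 solutions
    in positive \<open>x\<close> and \<open>y\<close> for each divisor \<open>d\<close>.\<close>
  have diag_f: "sum ?f (T (\<lambda>(a, b, x, y). a = b)) = (\<Sum>d | d dvd n. of_nat (n div d - 1) * F d d)"
  proof -
    have "(\<Sum>d | d dvd n. of_nat (n div d - 1) * F d d) = (\<Sum>d | d dvd n. \<Sum>x\<in>{0<..<n div d}. F d d)"
      by simp
    also have "\<dots> = (\<Sum>(d, x)\<in>(SIGMA d:{d. d dvd n}. {0<..<n div d}). F d d)"
      using \<open>0 < n\<close> by (subst sum.Sigma) auto
    also have "\<dots> = sum ?f (T (\<lambda>(a, b, x, y). a = b))"
    proof (rule sum.reindex_bij_witness)
      let ?i = "\<lambda>(a, b, x, y). (a, x)" and ?j = "\<lambda>(d, x). (d, d, x, n div d - x)"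
      fix t assume "t \<in> (SIGMA d:{d. d dvd n}. {0<..<n div d})"
      then obtain d k x where t: "t = (d, x)" "n = d * k" "0 < x" "x < k" "0 < d"
        using \<open>0 < n\<close> by (auto elim!: dvdE)
      then have "d * x + d * (k - x) = n"
        by (simp flip: add_mult_distrib2)
      with t show "?i (?j t) = t" "?j t \<in> T (\<lambda>(a, b, x, y). a = b)"
        "?f (?j t) = (case t of (d, x) \<Rightarrow> F d d)"
        by (auto simp: T_def quads_def)
    next
      let ?i = "\<lambda>(a, b, x, y). (a, x)" and ?j = "\<lambda>(d, x). (d, d, x, n div d - x)"
      fix t assume "t \<in> T (\<lambda>(a, b, x, y). a = b)"
      then obtain a x y where "t = (a, a, x, y)" "0 < a" "0 < x" "0 < y" "n = a * (x + y)"
        by (auto simp: T_def quads_def add_mult_distrib2)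
      then show "?j (?i t) = t" "?i t \<in> (SIGMA d:{d. d dvd n}. {0<..<n div d})"
        by auto
    qed
    finally show ?thesis by simp
  qed
  \<comment> \<open>With x = y the equation becomes (a + b) x = n, so d = a + b runs through the
    divisors of \<open>n\<close> and \<open>a\<close> through the positive numbers below
    \<open>d\<close>.\<close>
  have diag_g: "sum ?g (T (\<lambda>(a, b, x, y). x = y)) = (\<Sum>d | d dvd n. \<Sum>a\<in>{0<..<d}. F a d)"
  proof -
    have "(\<Sum>d | d dvd n. \<Sum>a\<in>{0<..<d}. F a d) = (\<Sum>(d, a)\<in>(SIGMA d:{d. d dvd n}. {0<..<d}). F a d)"
      using \<open>0 < n\<close> by (subst sum.Sigma) auto
    also have "\<dots> = sum ?g (T (\<lambda>(a, b, x, y). x = y))"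
    proof (rule sum.reindex_bij_witness)
      let ?i = "\<lambda>(a, b, x, y). (a + b, a)" and ?j = "\<lambda>(d, a). (a, d - a, n div d, n div d)"
      fix t assume "t \<in> (SIGMA d:{d. d dvd n}. {0<..<d})"
      then obtain d k a where t: "t = (d, a)" "n = d * k" "0 < a" "a < d" "0 < k"
        using \<open>0 < n\<close> by (auto elim!: dvdE)
      then have "a * k + (d - a) * k = n"
        by (simp flip: add_mult_distrib)
      with t show "?i (?j t) = t" "?j t \<in> T (\<lambda>(a, b, x, y). x = y)"
        "?g (?j t) = (case t of (d, a) \<Rightarrow> F a d)"
        by (auto simp: T_def quads_def)
    next
      let ?i = "\<lambda>(a, b, x, y). (a + b, a)" and ?j = "\<lambda>(d, a). (a, d - a, n div d, n div d)"
      fix t assume "t \<in> T (\<lambda>(a, b, x, y). x = y)"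
      then obtain a b x where "t = (a, b, x, x)" "0 < a" "0 < b" "0 < x" "n = (a + b) * x"
        by (auto simp: T_def quads_def add_mult_distrib)
      then show "?j (?i t) = t" "?i t \<in> (SIGMA d:{d. d dvd n}. {0<..<d})"
        by auto
    qed
    finally show ?thesis by simp
  qed
  have "(\<Sum>(a, b, x, y)\<in>quads n. F a b - F a (a + b)) = sum ?f (quads n) - sum ?g (quads n)"
    by (simp add: case_prod_unfold sum_subtractf)
  also have "\<dots> = sum ?f (T (\<lambda>(a, b, x, y). a = b)) - sum ?g (T (\<lambda>(a, b, x, y). x = y))"
    by (simp only: f_split g_split f_swap g_swap shifted) simp
  finally show ?thesis
    by (simp only: diag_f diag_g sum_subtractf)
qed

lemma numeral_mult_fps_nth: "(numeral k * f :: 'a::comm_ring_1 fps) $ n = numeral k * f $ n"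
  by (simp add: numeral_fps_const)

lemma quads_0: "quads 0 = {}"
  by (auto simp: quads_def)

text \<open>On the diagonal the factor n/d - 1 splits: n/d times \<open>F d d\<close> is n f(d), a
  coefficient of a derivative, and the other \<open>F d d\<close> supplies the term a = d that
  completes the sum over a < d. The constant \<open>c\<close> clears the denominators in the closed
  form of the completed sum.\<close>

lemma quads_sum_eq_divisor_fps:
  fixes F h :: "int \<Rightarrow> int \<Rightarrow> int"
  assumes sym: "\<And>a b. F a b = F b a"
    and shift: "\<And>a b. F a (a + b) = F b (a + b)"
    and diff: "\<And>a b. F a (a + b) - F a b = h a b"
    and diag: "\<And>d. F d d = d * f d"
    and sums: "\<And>d. c * (\<Sum>a=1..d. F (int a) (int d)) = g (int d)"
  shows "c * (\<Sum>(a, b, x, y)\<in>quads n. h (int a) (int b)) =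
         (divisor_fps (\<lambda>d. g (int d)) - fps_const c * fps_XD (divisor_fps (\<lambda>d. f (int d)))) $ n"
proof (cases "n = 0")
  case True
  then show ?thesis by (simp add: quads_0 divisor_fps_def)
next
  case False
  let ?F = "\<lambda>a b. F (int a) (int b)"
  have "(\<Sum>(a, b, x, y)\<in>quads n. h (int a) (int b)) =
      - (\<Sum>(a, b, x, y)\<in>quads n. ?F a b - ?F a (a + b))"
    unfolding sum_negf[symmetric] by (rule sum.cong) (auto simp flip: diff)
  also have "\<dots> = - (\<Sum>d | d dvd n. int (n div d - 1) * ?F d d - (\<Sum>a\<in>{0<..<d}. ?F a d))"
    using False by (subst quads_sum_shift[of ?F]) (auto intro: sym shift)
  also have "c * \<dots> = (\<Sum>d | d dvd n. g (int d) - c * (int n * f (int d)))"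
    unfolding sum_negf[symmetric] sum_distrib_left
  proof (rule sum.cong)
    fix d assume "d \<in> {d. d dvd n}"
    then obtain k where k: "n = d * k" by (auto elim: dvdE)
    with False have pos: "0 < d" "0 < k" by auto
    then have "{1..d} = insert d {0<..<d}" by auto
    then have g: "g (int d) = c * (?F d d + (\<Sum>a\<in>{0<..<d}. ?F a d))"
      by (simp flip: sums)
    have n: "int (n div d - 1) * ?F d d = int n * f (int d) - ?F d d"
      using pos by (simp add: k diag of_nat_diff algebra_simps)
    show "c * - (int (n div d - 1) * ?F d d - (\<Sum>a\<in>{0<..<d}. ?F a d)) =
        g (int d) - c * (int n * f (int d))"
      unfolding g n by (simp add: algebra_simps)
  qed simp
  finally show ?thesis
    using False by (simp add: divisor_fps_def sum_subtractf sum_distrib_left)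
qed

section \<open>Convolution identities for sums of odd powers of divisors\<close>

definition sigma_fps :: "nat \<Rightarrow> int fps" where
  "sigma_fps k = divisor_fps (\<lambda>d. int d ^ k)"

lemma divisor_sum_eq_sigma_fps:
  "(\<Sum>d | d dvd n \<and> 0 < n. int d ^ k) = sigma_fps k $ n"
  "(\<Sum>d | d dvd n \<and> 0 < n. c * int d ^ k) = c * sigma_fps k $ n"
  by (simp_all add: sigma_fps_def divisor_fps_def sum_distrib_left)

lemma quads_sum_eq_sigma_fps:
  "(\<Sum>t\<in>quads n. c * (int (fst t) ^ i * int (fst (snd t)) ^ j)) =
     c * (sigma_fps i * sigma_fps j) $ n"
  by (simp add: sigma_fps_def divisor_fps_mult_nth sum_distrib_left case_prod_unfold)

lemmas sigma_fps_relation_simps =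
  divisor_fps_def sum.distrib sum_subtractf case_prod_unfold numeral_mult_fps_nth
  divisor_sum_eq_sigma_fps quads_sum_eq_sigma_fps

text \<open>
  Polynomials in the following two forms meet the symmetry requirements of \<open>quads_sum_shift\<close>. Both
  are even under \<open>(a, b) \<mapsto> (-a, -b)\<close> and satisfy \<open>F(a, a + b) = F(a, -b)\<close>, so that \<open>F(a, a + b) -
  F(a, b)\<close> only contains monomials odd in both variables, which are the summands of the desired
  convolutions.
\<close>

definition norm_form :: "int \<Rightarrow> int \<Rightarrow> int" where
  "norm_form a b = a\<^sup>2 - a * b + b\<^sup>2"

definition disc_form :: "int \<Rightarrow> int \<Rightarrow> int" where
  "disc_form a b = (a * b * (a - b))\<^sup>2"

lemma norm_form_sym: "norm_form a b = norm_form b a"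
  and norm_form_shift: "norm_form a (a + b) = norm_form b (a + b)"
  and disc_form_sym: "disc_form a b = disc_form b a"
  and disc_form_shift: "disc_form a (a + b) = disc_form b (a + b)"
  by (simp_all add: norm_form_def disc_form_def power2_eq_square algebra_simps)

text \<open>Telescoping reduces a closed form for a sum to a single polynomial identity.\<close>

lemma sum_eq_if_difference:
  fixes f H :: "int \<Rightarrow> int"
  assumes "H 0 = 0" and step: "\<And>x. c * f (x + 1) = H (x + 1) - H x"
  shows "c * (\<Sum>a=1..m. f (int a)) = H (int m)"
proof (induction m)
  case (Suc m)
  then show ?case
    using step[of "int m"] by (simp add: distrib_left add.commute)
qed (use assms in simp)

text \<open>Here and in the next four lemmas the right-hand side is Faulhaber summation in the first
  argument. The upper limit \<open>m\<close> and the parameter \<open>e\<close> are kept apart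
  because telescoping needs \<open>e\<close> fixed; both become \<open>d\<close> afterwards.\<close>

lemma sum_norm_form:
  "6 * (\<Sum>a=1..m. norm_form (int a) e) =
    (\<lambda>x. 2 * x ^ 3 - 3 * x ^ 2 * e + 3 * x ^ 2 + 6 * x * e ^ 2 - 3 * x * e + x) (int m)"
  by (rule sum_eq_if_difference[where f = "\<lambda>x. norm_form x e"])
    (simp, unfold norm_form_def disc_form_def, algebra)

lemma sum_norm_form_power2:
  "30 * (\<Sum>a=1..m. norm_form (int a) e ^ 2) =
    (\<lambda>x. 6 * x ^ 5 - 15 * x ^ 4 * e + 15 * x ^ 4 + 30 * x ^ 3 * e ^ 2 - 30 * x ^ 3 * e
        + 10 * x ^ 3 - 30 * x ^ 2 * e ^ 3 + 45 * x ^ 2 * e ^ 2 - 15 * x ^ 2 * e + 30 * x * e ^ 4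
        - 30 * x * e ^ 3 + 15 * x * e ^ 2 - x) (int m)"
  by (rule sum_eq_if_difference[where f = "\<lambda>x. norm_form x e ^ 2"])
    (simp, unfold norm_form_def disc_form_def, algebra)

lemma sum_norm_form_power3:
  "420 * (\<Sum>a=1..m. norm_form (int a) e ^ 3) =
    (\<lambda>x. 60 * x ^ 7 - 210 * x ^ 6 * e + 210 * x ^ 6 + 504 * x ^ 5 * e ^ 2
        - 630 * x ^ 5 * e + 210 * x ^ 5 - 735 * x ^ 4 * e ^ 3 + 1260 * x ^ 4 * e ^ 2
        - 525 * x ^ 4 * e + 840 * x ^ 3 * e ^ 4 - 1470 * x ^ 3 * e ^ 3 + 840 * x ^ 3 * e ^ 2
        - 70 * x ^ 3 - 630 * x ^ 2 * e ^ 5 + 1260 * x ^ 2 * e ^ 4 - 735 * x ^ 2 * e ^ 3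
        + 105 * x ^ 2 * e + 420 * x * e ^ 6 - 630 * x * e ^ 5 + 420 * x * e ^ 4
        - 84 * x * e ^ 2 + 10 * x) (int m)"
  by (rule sum_eq_if_difference[where f = "\<lambda>x. norm_form x e ^ 3"])
    (simp, unfold norm_form_def disc_form_def, algebra)

lemma sum_disc_form:
  "30 * (\<Sum>a=1..m. disc_form (int a) e) =
    (\<lambda>x. 6 * x ^ 5 * e ^ 2 - 15 * x ^ 4 * e ^ 3 + 15 * x ^ 4 * e ^ 2
        + 10 * x ^ 3 * e ^ 4 - 30 * x ^ 3 * e ^ 3 + 10 * x ^ 3 * e ^ 2 + 15 * x ^ 2 * e ^ 4
        - 15 * x ^ 2 * e ^ 3 + 5 * x * e ^ 4 - x * e ^ 2) (int m)"
  by (rule sum_eq_if_difference[where f = "\<lambda>x. disc_form x e"])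
    (simp, unfold norm_form_def disc_form_def, algebra)

lemma sum_norm_disc_form:
  "420 * (\<Sum>a=1..m. norm_form (int a) e * disc_form (int a) e) =
    (\<lambda>x. 60 * x ^ 7 * e ^ 2 - 210 * x ^ 6 * e ^ 3 + 210 * x ^ 6 * e ^ 2
        + 336 * x ^ 5 * e ^ 4 - 630 * x ^ 5 * e ^ 3 + 210 * x ^ 5 * e ^ 2 - 315 * x ^ 4 * e ^ 5
        + 840 * x ^ 4 * e ^ 4 - 525 * x ^ 4 * e ^ 3 + 140 * x ^ 3 * e ^ 6 - 630 * x ^ 3 * e ^ 5
        + 560 * x ^ 3 * e ^ 4 - 70 * x ^ 3 * e ^ 2 + 210 * x ^ 2 * e ^ 6 - 315 * x ^ 2 * e ^ 5
        + 105 * x ^ 2 * e ^ 3 + 70 * x * e ^ 6 - 56 * x * e ^ 4 + 10 * x * e ^ 2) (int m)"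
  by (rule sum_eq_if_difference[where f = "\<lambda>x. norm_form x e * disc_form x e"])
    (simp, unfold norm_form_def disc_form_def, algebra)

text \<open>For \<open>norm_form\<close> the difference \<open>F a (a + b) - F a b\<close> is 2 a b
  and the diagonal value is d^2. The identity amounts to Ramanujan's formula for the derivative of
  \<open>E2\<close>.\<close>

lemma sigma_1_1:
  "12 * sigma_fps 1 ^ 2 = 5 * sigma_fps 3 + sigma_fps 1 - 6 * fps_XD (sigma_fps 1)"
proof (rule fps_ext)
  fix n
  have "6 * (\<Sum>(a, b, x, y)\<in>quads n. (\<lambda>a b. 2 * (a ^ 1 * b ^ 1)) (int a) (int b)) =
      (divisor_fps (\<lambda>d. (\<lambda>d. 5 * d ^ 3 + d ^ 1) (int d)) -
        fps_const 6 * fps_XD (divisor_fps (\<lambda>d. (\<lambda>d. d ^ 1) (int d)))) $ n"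
    by (rule quads_sum_eq_divisor_fps[where F = "norm_form"])
      (unfold sum_norm_form,
        simp_all only: norm_form_sym disc_form_sym norm_form_shift disc_form_shift,
        unfold norm_form_def disc_form_def, (algebra | simp)+)
  then show "(12 * sigma_fps 1 ^ 2) $ n = (5 * sigma_fps 3 + sigma_fps 1
      - 6 * fps_XD (sigma_fps 1)) $ n"
    by (simp add: power2_eq_square sigma_fps_relation_simps
      del: power_one_right One_nat_def)
qed

text \<open>With A = a^2 + b^2 and B = a b, the squared form gives (A + B)^2 - (A - B)^2 = 4 A B.
  Its two monomials have the same convolution, whence 240 = 30 * 8.\<close>

lemma sigma_1_3:
  "240 * (sigma_fps 1 * sigma_fps 3) = 21 * sigma_fps 5 + 10 * sigma_fps 3 - sigma_fps 1
      - 30 * fps_XD (sigma_fps 3)"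
proof (rule fps_ext)
  fix n
  have "30 * (\<Sum>(a, b, x, y)\<in>quads n. (\<lambda>a b. 4 * (a ^ 1 * b ^ 3)
      + 4 * (a ^ 3 * b ^ 1)) (int a) (int b)) =
      (divisor_fps (\<lambda>d. (\<lambda>d. 21 * d ^ 5 + 10 * d ^ 3 - d ^ 1) (int d)) -
        fps_const 30 * fps_XD (divisor_fps (\<lambda>d. (\<lambda>d. d ^ 3) (int d)))) $ n"
    by (rule quads_sum_eq_divisor_fps[where F = "\<lambda>a b. norm_form a b ^ 2"])
      (unfold sum_norm_form_power2,
        simp_all only: norm_form_sym disc_form_sym norm_form_shift disc_form_shift,
        unfold norm_form_def disc_form_def, (algebra | simp)+)
  then show "(240 * (sigma_fps 1 * sigma_fps 3)) $ n = (21 * sigma_fps 5 + 10 * sigma_fps 3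
      - sigma_fps 1 - 30 * fps_XD (sigma_fps 3)) $ n"
    by (simp add: power2_eq_square mult.commute[of "sigma_fps 3" "sigma_fps 1"]
      sigma_fps_relation_simps del: power_one_right One_nat_def)
qed

text \<open>\<open>disc_form\<close> vanishes on the diagonal, so no derivative occurs, and the
  difference is 4 a^3 b^3. This is the relation E8 = E4^2.\<close>

lemma sigma_3_3:
  "120 * sigma_fps 3 ^ 2 = sigma_fps 7 - sigma_fps 3"
proof (rule fps_ext)
  fix n
  have "30 * (\<Sum>(a, b, x, y)\<in>quads n. (\<lambda>a b. 4 * (a ^ 3 * b ^ 3)) (int a) (int b)) =
      (divisor_fps (\<lambda>d. (\<lambda>d. d ^ 7 - d ^ 3) (int d)) -
        fps_const 30 * fps_XD (divisor_fps (\<lambda>d. (\<lambda>d. 0) (int d)))) $ n"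
    by (rule quads_sum_eq_divisor_fps[where F = "disc_form"])
      (unfold sum_disc_form,
        simp_all only: norm_form_sym disc_form_sym norm_form_shift disc_form_shift,
        unfold norm_form_def disc_form_def, (algebra | simp)+)
  then show "(120 * sigma_fps 3 ^ 2) $ n = (sigma_fps 7 - sigma_fps 3) $ n"
    by (simp add: power2_eq_square sigma_fps_relation_simps
      del: power_one_right One_nat_def)
qed

text \<open>With A = a^2 + b^2 and B = a b, the cubed form gives (A + B)^3 - (A - B)^3 = 6 A^2 B + 2
  B^3. This contains a^3 b^3 besides the desired monomials; that part is later eliminated by
  \<open>sigma_3_3\<close>.\<close>

lemma sigma_1_5_3_3:
  "5040 * (sigma_fps 1 * sigma_fps 5) + 5880 * sigma_fps 3 ^ 2 = 249 * sigma_fps 7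
      + 210 * sigma_fps 5 - 49 * sigma_fps 3 + 10 * sigma_fps 1 - 420 * fps_XD (sigma_fps 5)"
proof (rule fps_ext)
  fix n
  have "420 * (\<Sum>(a, b, x, y)\<in>quads n. (\<lambda>a b. 6 * (a ^ 1 * b ^ 5)
      + 6 * (a ^ 5 * b ^ 1) + 14 * (a ^ 3 * b ^ 3)) (int a) (int b)) =
      (divisor_fps (\<lambda>d. (\<lambda>d. 249 * d ^ 7 + 210 * d ^ 5 - 49 * d ^ 3 + 10 * d ^ 1) (int d)) -
        fps_const 420 * fps_XD (divisor_fps (\<lambda>d. (\<lambda>d. d ^ 5) (int d)))) $ n"
    by (rule quads_sum_eq_divisor_fps[where F = "\<lambda>a b. norm_form a b ^ 3"])
      (unfold sum_norm_form_power3,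
        simp_all only: norm_form_sym disc_form_sym norm_form_shift disc_form_shift,
        unfold norm_form_def disc_form_def, (algebra | simp)+)
  then show "(5040 * (sigma_fps 1 * sigma_fps 5) + 5880 * sigma_fps 3 ^ 2) $ n
      = (249 * sigma_fps 7 + 210 * sigma_fps 5 - 49 * sigma_fps 3 + 10 * sigma_fps 1
      - 420 * fps_XD (sigma_fps 5)) $ n"
    by (simp add: power2_eq_square mult.commute[of "sigma_fps 5" "sigma_fps 1"]
      sigma_fps_relation_simps del: power_one_right One_nat_def)
qed

text \<open>The factor \<open>disc_form\<close> again removes the diagonal. This is the relation E10
  = E4 E6.\<close>

lemma sigma_3_5:
  "5040 * (sigma_fps 3 * sigma_fps 5) = 11 * sigma_fps 9 - 21 * sigma_fps 5 + 10 * sigma_fps 3"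
proof (rule fps_ext)
  fix n
  have "420 * (\<Sum>(a, b, x, y)\<in>quads n. (\<lambda>a b. 6 * (a ^ 3 * b ^ 5)
      + 6 * (a ^ 5 * b ^ 3)) (int a) (int b)) =
      (divisor_fps (\<lambda>d. (\<lambda>d. 11 * d ^ 9 - 21 * d ^ 5 + 10 * d ^ 3) (int d)) -
        fps_const 420 * fps_XD (divisor_fps (\<lambda>d. (\<lambda>d. 0) (int d)))) $ n"
    by (rule quads_sum_eq_divisor_fps[where F = "\<lambda>a b. norm_form a b * disc_form a b"])
      (unfold sum_norm_disc_form,
        simp_all only: norm_form_sym disc_form_sym norm_form_shift disc_form_shift,
        unfold norm_form_def disc_form_def, (algebra | simp)+)
  then show "(5040 * (sigma_fps 3 * sigma_fps 5)) $ n = (11 * sigma_fps 9 - 21 * sigma_fps 5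
      + 10 * sigma_fps 3) $ n"
    by (simp add: power2_eq_square mult.commute[of "sigma_fps 5" "sigma_fps 3"]
      sigma_fps_relation_simps del: power_one_right One_nat_def)
qed

subsection \<open>Elementary symmetric functions and power sums\<close>

definition esym :: "('b \<Rightarrow> 'a::comm_ring_1) \<Rightarrow> 'b set \<Rightarrow> nat \<Rightarrow> 'a" where
  "esym u A k = (\<Sum>S | S \<subseteq> A \<and> card S = k. \<Prod>x\<in>S. u x)"

lemma esym_0:
  assumes "finite A"
  shows "esym u A 0 = 1"
proof -
  have "{S. S \<subseteq> A \<and> card S = 0} = {{}}"
    using assms finite_subset by fastforce
  then show ?thesis by (simp add: esym_def)
qed

lemma esym_empty_Suc: "esym u {} (Suc k) = 0"
  unfolding esym_def by (rule sum.neutral) auto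

text \<open>A subset with \<open>Suc k\<close> elements either avoids \<open>x\<close> or arises by
  adding \<open>x\<close> to a subset with \<open>k\<close> elements.\<close>

lemma esym_insert_Suc:
  assumes "finite A" "x \<notin> A"
  shows "esym u (insert x A) (Suc k) = esym u A (Suc k) + u x * esym u A k"
proof -
  let ?P = "\<lambda>k. {S. S \<subseteq> A \<and> card S = k}"
  have fin: "finite S" and nin: "x \<notin> S" if "S \<subseteq> A" for S
    using assms that finite_subset by auto
  have "{S. S \<subseteq> insert x A \<and> card S = Suc k} = ?P (Suc k) \<union> insert x ` ?P k"
  proof (intro subset_antisym subsetI)
    fix S assume S: "S \<in> {S. S \<subseteq> insert x A \<and> card S = Suc k}"
    show "S \<in> ?P (Suc k) \<union> insert x ` ?P k"
    proof (cases "x \<in> S")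
      case True
      with S have "S - {x} \<in> ?P k" by auto
      moreover have "S = insert x (S - {x})" using True by auto
      ultimately show ?thesis by blast
    qed (use S in auto)
  qed (use fin nin in auto)
  moreover have "?P (Suc k) \<inter> insert x ` ?P k = {}"
    using assms by auto
  moreover have "inj_on (insert x) (?P k)"
    using assms by (auto simp: inj_on_def insert_ident)
  ultimately have "esym u (insert x A) (Suc k) =
      (\<Sum>S\<in>?P (Suc k). \<Prod>x\<in>S. u x) + (\<Sum>S\<in>?P k. \<Prod>x\<in>insert x S. u x)"
    using assms by (simp add: esym_def sum.union_disjoint sum.reindex)
  also have "(\<Sum>S\<in>?P k. \<Prod>x\<in>insert x S. u x) = u x * esym u A k"
    unfolding esym_def sum_distrib_left using fin nin by (intro sum.cong) auto
  finally show ?thesis by (simp add: esym_def)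
qed

text \<open>Newton's identities, by induction on the set. With u for \<open>u x\<close>, adding
  \<open>x\<close> turns e(k+1) into e(k+1) + u e(k) and p(i) into p(i) + u^(i+1). The induction
  hypothesis handles the old power sums, and the contribution of the new powers collapses.\<close>

lemma esym_Newton:
  assumes "finite A"
  shows "(\<Sum>i\<le>m. (-1) ^ i * (esym u A (m - i) * (\<Sum>x\<in>A. u x ^ Suc i))) =
         of_nat (Suc m) * esym u A (Suc m)"
  using assms
proof (induction A arbitrary: m rule: finite_induct)
  case empty
  then show ?case by (simp add: esym_empty_Suc)
next
  case (insert x A)
  define e e' where "e = esym u A" and "e' = esym u (insert x A)"
  define p where "p i = (\<Sum>x\<in>A. u x ^ Suc i)" for i
  have e0: "e 0 = 1" "e' 0 = 1"
    using insert by (simp_all add: e_def e'_def esym_0)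
  have e': "e' (Suc k) = e (Suc k) + u x * e k" for k
    using insert by (simp add: e_def e'_def esym_insert_Suc)
  have p: "(\<Sum>y\<in>insert x A. u y ^ Suc i) = p i + u x ^ Suc i" for i
    using insert by (simp add: p_def add.commute)
  have IH: "(\<Sum>i\<le>k. (-1) ^ i * (e (k - i) * p i)) = of_nat (Suc k) * e (Suc k)" for k
    unfolding e_def p_def by (rule insert.IH)
  \<comment> \<open>By the recursion for \<open>e'\<close> the alternating sum collapses to one
    term; the old power sums do not enter.\<close>
  have powers: "(\<Sum>i\<le>k. (-1) ^ i * (e' (k - i) * u x ^ Suc i)) = u x * e k" for k
  proof (induction k)
    case (Suc k)
    have "(\<Sum>i\<le>Suc k. (-1) ^ i * (e' (Suc k - i) * u x ^ Suc i)) =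
        e' (Suc k) * u x - u x * (\<Sum>i\<le>k. (-1) ^ i * (e' (k - i) * u x ^ Suc i))"
      by (simp only: sum.atMost_Suc_shift) (simp add: sum_distrib_left sum_negf algebra_simps)
    also have "\<dots> = u x * e (Suc k)"
      by (simp only: Suc e') (simp add: algebra_simps)
    finally show ?case .
  qed (simp add: e0)
  \<comment> \<open>Expanding \<open>e'\<close> calls for the induction hypothesis at
    \<open>m\<close> and, in the part with the factor \<open>u x\<close>, at \<open>m - 1\<close>;
    hence the separate case m = 0.\<close>
  have "(\<Sum>i\<le>m. (-1) ^ i * (e' (m - i) * p i)) =
      of_nat (Suc m) * e (Suc m) + u x * (of_nat m * e m)"
  proof (cases m)
    case 0
    then show ?thesis using IH[of 0] by (simp add: e0)
  next
    case (Suc k)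
    have "(\<Sum>i\<le>m. (-1) ^ i * (e' (m - i) * p i)) =
        (\<Sum>i\<le>k. (-1) ^ i * ((e (m - i) + u x * e (k - i)) * p i)) + (-1) ^ m * (e (m - m) * p m)"
      by (simp add: Suc e' e0 Suc_diff_le)
    also have "\<dots> = (\<Sum>i\<le>m. (-1) ^ i * (e (m - i) * p i))
        + u x * (\<Sum>i\<le>k. (-1) ^ i * (e (k - i) * p i))"
      by (simp add: Suc sum.distrib sum_distrib_left algebra_simps)
    finally show ?thesis by (simp only: IH Suc)
  qed
  then have "(\<Sum>i\<le>m. (-1) ^ i * (e' (m - i) * (p i + u x ^ Suc i))) =
      of_nat (Suc m) * e (Suc m) + u x * (of_nat m * e m) + u x * e m"
    using powers[of m] by (simp only: distrib_left sum.distrib)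
  also have "\<dots> = of_nat (Suc m) * e' (Suc m)"
    by (simp add: e' algebra_simps)
  finally show ?case by (simp only: p e'_def)
qed

section \<open>The series as elementary symmetric functions\<close>

lemma MO_term_singleton_mult:
  assumes "0 < k"
  shows "MO_term [k] * (1 - fps_X ^ k)\<^sup>2 = fps_X ^ k"
  using MO_term_mult[of "[k]" 1] assms by (simp add: MO_index_def)

lemma one_minus_fps_X_power_square_nonzero:
  assumes "0 < k"
  shows "((1 - fps_X ^ k)\<^sup>2 :: int fps) \<noteq> 0"
proof -
  have "(1 - fps_X ^ k :: int fps) $ 0 = 1" using assms by simp
  then show ?thesis by (metis fps_zero_nth power_not_zero zero_neq_one)
qed

text \<open>Multiplied by the product of all (1 - q^k)^2, both sides become the same power of q, and
  this product is a nonzero element of an integral domain.\<close>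

lemma MO_term_eq_prod:
  assumes "ks \<in> MO_index a"
  shows "MO_term ks = (\<Prod>k\<in>set ks. MO_term [k])"
proof -
  have ks: "distinct ks" "length ks = a" "\<And>k. k \<in> set ks \<Longrightarrow> 0 < k"
    using assms by (auto simp: MO_index_def strict_sorted_iff)
  have nth: "(\<Prod>i<a. g (ks ! i)) = (\<Prod>k\<in>set ks. g k)" for g :: "nat \<Rightarrow> int fps"
    using ks by (simp add: prod.distinct_set_conv_list prod.list_conv_set_nth lessThan_atLeast0)
  let ?w = "\<Prod>k\<in>set ks. (1 - fps_X ^ k :: int fps)\<^sup>2"
  have "(\<Prod>k\<in>set ks. MO_term [k]) * ?w = (\<Prod>k\<in>set ks. fps_X ^ k)"
    unfolding prod.distrib[symmetric] using ks by (intro prod.cong) (auto simp: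
        MO_term_singleton_mult)
  also have "\<dots> = fps_X ^ sum_list ks"
    using ks by (simp add: power_sum distinct_sum_list_conv_Sum)
  also have "\<dots> = MO_term ks * ?w"
    using MO_term_mult[OF assms] by (simp add: nth[of "\<lambda>k. (1 - fps_X ^ k)\<^sup>2"])
  finally have "(\<Prod>k\<in>set ks. MO_term [k]) * ?w = MO_term ks * ?w" .
  moreover have "?w \<noteq> 0"
    using ks one_minus_fps_X_power_square_nonzero by (simp only: prod_zero_iff List.finite_set)
        blast
  ultimately show ?thesis by simp
qed

lemma MO_term_nth_eq_0:
  assumes "n < sum_list ks"
  shows "MO_term ks $ n = 0"
  using assms by (simp add: MO_term_def fps_X_power_mult_nth)

text \<open>Increasing lists correspond to subsets, and a list with an entry above \<open>K\<close>
  has sum above \<open>n\<close>, so it does not affect this coefficient. The infinite sum is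
  thereby truncated to a finite set, where Newton's identities are available.\<close>

lemma MO_series_nth:
  assumes "n \<le> K"
  shows "MO_series a $ n = esym (\<lambda>k. MO_term [k]) {1..K} a $ n"
proof -
  let ?I = "{ks \<in> MO_index a. set ks \<subseteq> {1..K}}"
  have "bij_betw set ?I {S. S \<subseteq> {1..K} \<and> card S = a}"
  proof (rule bij_betw_byWitness[where f' = sorted_list_of_set])
    show "\<forall>ks\<in>?I. sorted_list_of_set (set ks) = ks"
      by (auto simp: MO_index_def strict_sorted_iff sorted_list_of_set.idem_if_sorted_distinct)
    show "\<forall>S\<in>{S. S \<subseteq> {1..K} \<and> card S = a}. set (sorted_list_of_set S) = S"
      using finite_subset by fastforce
    show "set ` ?I \<subseteq> {S. S \<subseteq> {1..K} \<and> card S = a}"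
      by (auto simp: MO_index_def strict_sorted_iff distinct_card)
    show "sorted_list_of_set ` {S. S \<subseteq> {1..K} \<and> card S = a} \<subseteq> ?I"
    proof (rule image_subsetI)
      fix S assume "S \<in> {S. S \<subseteq> {1..K} \<and> card S = a}"
      moreover from this have "finite S" using finite_subset by blast
      ultimately show "sorted_list_of_set S \<in> ?I"
        by (auto simp: MO_index_def)
    qed
  qed
  then have "esym (\<lambda>k. MO_term [k]) {1..K} a = (\<Sum>ks\<in>?I. \<Prod>k\<in>set ks. MO_term [k])"
    by (simp add: esym_def sum.reindex_bij_betw[symmetric])
  also have "\<dots> = sum MO_term ?I"
    by (rule sum.cong) (auto simp: MO_term_eq_prod)
  finally have esym: "esym (\<lambda>k. MO_term [k]) {1..K} a = sum MO_term ?I" .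
  have fin: "finite ?I"
    by (rule finite_subset[OF _ finite_lists_length_eq[of "{1..K}" a]]) (auto simp: MO_index_def)
  have "MO_series a $ n = (\<Sum>ks | ks \<in> MO_index a \<and> MO_term ks $ n \<noteq> 0. MO_term ks $ n)"
    by (rule has_sum_fpsD(2)[OF MO_has_sum])
  also have "\<dots> = (\<Sum>ks\<in>?I. MO_term ks $ n)"
  proof (rule sum.mono_neutral_left)
    show "{ks. ks \<in> MO_index a \<and> MO_term ks $ n \<noteq> 0} \<subseteq> ?I"
    proof
      fix ks assume "ks \<in> {ks. ks \<in> MO_index a \<and> MO_term ks $ n \<noteq> 0}"
      then have ks: "ks \<in> MO_index a" "sum_list ks \<le> n"
        using MO_term_nth_eq_0 by (auto simp: not_less[symmetric])
      have "k \<in> {1..K}" if "k \<in> set ks" for k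
        using ks member_le_sum_list[OF that] that assms by (auto simp: MO_index_def Suc_le_eq)
      with ks show "ks \<in> ?I" by blast
    qed
  qed (use fin in auto)
  also have "\<dots> = sum MO_term ?I $ n"
    by (simp add: fps_sum_nth)
  finally show ?thesis by (simp only: esym)
qed

text \<open>For positive \<open>r\<close> this is the sum of \<open>u\<^sub>k ^ r\<close> over all
  k, written coefficientwise: the k-th summand is divisible by q^k, so only k \<le> n matters for
  the coefficient of q^n.\<close>

definition MO_power_sum :: "nat \<Rightarrow> int fps" where
  "MO_power_sum r = Abs_fps (\<lambda>n. (\<Sum>k=1..n. MO_term [k] ^ r) $ n)"

lemma MO_power_sum_nth:
  assumes "n \<le> K" "0 < r"
  shows "MO_power_sum r $ n = (\<Sum>k=1..K. MO_term [k] ^ r) $ n"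
proof -
  obtain s where s: "r = Suc s" using assms by (cases r) auto
  have "(MO_term [k] ^ r) $ n = 0" if "n < k" for k
  proof -
    have "MO_term [k] ^ r = fps_X ^ k * (fps_right_inverse ((1 - fps_X ^ k)\<^sup>2) 1 * MO_term [k] ^ s)"
      by (simp add: s MO_term_def mult.assoc)
    then show ?thesis using that by (simp only: fps_X_power_mult_nth) simp
  qed
  then show ?thesis
    unfolding MO_power_sum_def fps_sum_nth using assms
    by (simp add: fps_sum_nth) (rule sum.mono_neutral_left, auto)
qed

lemma fps_mult_nth_cong:
  assumes "\<And>i. i \<le> n \<Longrightarrow> f $ i = f' $ i" "\<And>i. i \<le> n \<Longrightarrow> g $ i = g' $ i"
  shows "(f * g) $ n = (f' * g' :: 'a::comm_ring_1 fps) $ n"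
  unfolding fps_mult_nth by (rule sum.cong) (use assms in auto)

lemma minus_one_power_mult_fps_nth:
  "((-1) ^ i * f :: 'a::comm_ring_1 fps) $ n = (-1) ^ i * f $ n"
  by (cases "even i") simp_all

lemma of_nat_mult_fps_nth: "(of_nat k * f :: 'a::comm_ring_1 fps) $ n = of_nat k * f $ n"
  by (simp only: fps_of_nat[symmetric] fps_mult_left_const_nth)

text \<open>A coefficient of a product depends only on the coefficients of the factors up to the
  same index, and up to index \<open>n\<close> all series agree with their truncations to
  {1..n}.\<close>

lemma MO_series_Newton:
  "of_nat (Suc m) * MO_series (Suc m) =
     (\<Sum>i\<le>m. (-1) ^ i * (MO_series (m - i) * MO_power_sum (Suc i)))"
proof (rule fps_ext)
  fix n
  let ?u = "\<lambda>k. MO_term [k]"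
  have "(MO_series (m - i) * MO_power_sum (Suc i)) $ n =
      (esym ?u {1..n} (m - i) * (\<Sum>k=1..n. ?u k ^ Suc i)) $ n" for i
    by (rule fps_mult_nth_cong) (erule MO_series_nth, erule MO_power_sum_nth, simp)
  then have "(\<Sum>i\<le>m. (-1) ^ i * (MO_series (m - i) * MO_power_sum (Suc i))) $ n =
      (\<Sum>i\<le>m. (-1) ^ i * (esym ?u {1..n} (m - i) * (\<Sum>k=1..n. ?u k ^ Suc i))) $ n"
    by (simp only: fps_sum_nth minus_one_power_mult_fps_nth)
  also have "\<dots> = (of_nat (Suc m) * MO_series (Suc m)) $ n"
    by (subst esym_Newton) (simp_all only: of_nat_mult_fps_nth MO_series_nth[OF order_refl]
        finite_atLeastAtMost)
  finally show "(of_nat (Suc m) * MO_series (Suc m)) $ n =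
      (\<Sum>i\<le>m. (-1) ^ i * (MO_series (m - i) * MO_power_sum (Suc i))) $ n" ..
qed

lemma MO_series_0: "MO_series 0 = 1"
  by (rule fps_ext) (simp add: MO_series_nth[OF order_refl] esym_0)

section \<open>Powers of q^k / (1 - q^k)^2 and their sums over k\<close>

text \<open>The series \<Sum> g(m) q^(k m). The argument of \<open>g\<close> is an integer, so that
  polynomial identities involve no truncated subtraction.\<close>

definition inflate :: "nat \<Rightarrow> (int \<Rightarrow> int) \<Rightarrow> int fps" where
  "inflate k g = Abs_fps (\<lambda>n. if k dvd n then g (int (n div k)) else 0)"

text \<open>Multiplication by (1 - q^k)^2 takes second differences of \<open>g\<close>, and the
  factor q^k on the right accounts for \<open>h\<close> being evaluated at the midpoint
  \<open>x + 1\<close>. The conditions on \<open>g 0\<close> and \<open>g 1\<close> are the two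
  boundary coefficients.\<close>

lemma inflate_mult:
  assumes "0 < k" "g 0 = 0" "g 1 = h 0"
    and diff: "\<And>x. 0 \<le> x \<Longrightarrow> g (x + 2) - 2 * g (x + 1) + g x = h (x + 1)"
  shows "inflate k g * (1 - fps_X ^ k)\<^sup>2 = inflate k h * fps_X ^ k"
proof (rule fps_ext)
  fix n
  have "inflate k g * (1 - fps_X ^ k)\<^sup>2 =
      inflate k g - 2 * (inflate k g * fps_X ^ k) + inflate k g * fps_X ^ (2 * k)"
    unfolding mult.commute[of 2 k] power_mult by algebra
  then have eq: "(inflate k g * (1 - fps_X ^ k)\<^sup>2) $ n =
      inflate k g $ n - 2 * (if n < k then 0 else inflate k g $ (n - k)) +
        (if n < 2 * k then 0 else inflate k g $ (n - 2 * k))"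
    by (simp add: numeral_mult_fps_nth fps_X_power_mult_right_nth)
  show "(inflate k g * (1 - fps_X ^ k)\<^sup>2) $ n = (inflate k h * fps_X ^ k) $ n"
  proof (cases "k dvd n")
    case True
    then obtain m where m: "n = k * m" by (auto elim: dvdE)
    consider "m = 0" | "m = 1" | j where "m = j + 2"
      by (metis One_nat_def add_2_eq_Suc' not0_implies_Suc)
    then show ?thesis
    proof cases
      case 3
      then have "n - k = k * (j + 1)" "n - 2 * k = k * j" "\<not> n < k" "\<not> n < 2 * k" "n = k * (j + 2)"
        using m by (simp_all add: algebra_simps)
      then show ?thesis
        unfolding eq fps_X_power_mult_right_nth using diff[of "int j"] \<open>0 < k\<close>
        by (simp add: inflate_def add.commute del: mult_Suc_right)
    qed (unfold eq fps_X_power_mult_right_nth, use assms m in \<open>simp_all add: inflate_def\<close>)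
  next
    case False
    then have "\<not> k dvd n - k" if "k \<le> n" using False that dvd_diffD[of k n k] by auto
    moreover have "\<not> k dvd n - 2 * k" if "2 * k \<le> n"
      using False that dvd_diffD[of k n "2 * k"] by auto
    ultimately show ?thesis
      unfolding eq fps_X_power_mult_right_nth using False by (auto simp: inflate_def)
  qed
qed

text \<open>The identity has vanishing second differences, so after multiplication by (1 - q^k)^2
  only the boundary coefficient at q^k survives.\<close>

lemma MO_term_singleton:
  assumes "0 < k"
  shows "MO_term [k] = inflate k (\<lambda>x. x)"
proof -
  have "inflate k (\<lambda>x. x) * (1 - fps_X ^ k)\<^sup>2 = inflate k (\<lambda>x. if x = 0 then 1 else 0) * fps_X ^ k"
    by (rule inflate_mult) (use assms in auto)
  also have "inflate k (\<lambda>x. if x = 0 then 1 else 0) = 1"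
    using assms by (intro fps_ext) (auto simp: inflate_def dvd_div_eq_0_iff)
  also have "1 * fps_X ^ k = MO_term [k] * (1 - fps_X ^ k)\<^sup>2"
    using assms by (simp add: MO_term_singleton_mult)
  finally show ?thesis
    by (simp only: mult_right_cancel[OF one_minus_fps_X_power_square_nonzero[OF \<open>0 < k\<close>]])
qed

text \<open>One more factor \<open>MO_term [k]\<close> amounts to solving a second-order difference
  equation: multiplying both sides by (1 - q^k)^2 leads back to \<open>h\<close>, and this factor
  can be cancelled.\<close>

lemma MO_term_singleton_power_Suc:
  assumes "0 < k" and h: "fps_const c * MO_term [k] ^ r = inflate k h"
    and "g 0 = 0" "g 1 = 0" "h 0 = 0"
    and diff: "\<And>x. g (x + 2) - 2 * g (x + 1) + g x = d * h (x + 1)"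
  shows "fps_const (d * c) * MO_term [k] ^ Suc r = inflate k g"
proof -
  have "inflate k g * (1 - fps_X ^ k)\<^sup>2 = inflate k (\<lambda>x. d * h x) * fps_X ^ k"
    by (rule inflate_mult) (use assms in auto)
  also have "inflate k (\<lambda>x. d * h x) = fps_const d * inflate k h"
    by (rule fps_ext) (simp add: inflate_def)
  also have "\<dots> * fps_X ^ k = fps_const d * (fps_const c * MO_term [k] ^ r) *
      (MO_term [k] * (1 - fps_X ^ k)\<^sup>2)"
    using assms(1) by (simp add: h MO_term_singleton_mult)
  also have "\<dots> = fps_const (d * c) * MO_term [k] ^ Suc r * (1 - fps_X ^ k)\<^sup>2"
    by (simp add: fps_const_mult[symmetric] mult_ac del: fps_const_mult)
  finally show ?thesis
    by (simp only: mult_right_cancel[OF one_minus_fps_X_power_square_nonzero[OF \<open>0 < k\<close>]])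
qed

text \<open>Summing over k gives g(n/k) for each divisor k of n; passing to the complementary
  divisor yields a divisor series.\<close>

lemma MO_power_sum_eq_divisor_fps:
  assumes "\<And>k. 0 < k \<Longrightarrow> fps_const c * MO_term [k] ^ r = inflate k g"
  shows "fps_const c * MO_power_sum r = divisor_fps (\<lambda>d. g (int d))"
proof (rule fps_ext)
  fix n
  have "(fps_const c * MO_power_sum r) $ n = (\<Sum>k=1..n. fps_const c * MO_term [k] ^ r) $ n"
    by (simp add: MO_power_sum_def fps_sum_nth sum_distrib_left)
  also have "\<dots> = (\<Sum>k=1..n. inflate k g $ n)"
    by (simp add: fps_sum_nth assms)
  also have "\<dots> = (\<Sum>k | k dvd n \<and> 0 < n. g (int (n div k)))"
    unfolding inflate_def fps_nth_Abs_fps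
    by (rule sum.mono_neutral_cong_right) (auto dest: dvd_imp_le intro!: Nat.gr0I)
  also have "\<dots> = divisor_fps (\<lambda>d. g (int d)) $ n"
    unfolding divisor_fps_def fps_nth_Abs_fps
    by (rule sum.reindex_bij_witness[of _ "\<lambda>d. n div d" "\<lambda>d. n div d"]) (auto elim!: dvdE)
  finally show "(fps_const c * MO_power_sum r) $ n = divisor_fps (\<lambda>d. g (int d)) $ n" .
qed

text \<open>The polynomial for the power r is x (x^2 - 1) (x^2 - 4) ... (x^2 - (r-1)^2), with
  scaling factor (2r - 1)!. Only odd powers of x occur, hence only odd divisor sums.\<close>

lemma MO_term_singleton_powers:
  assumes "0 < k"
  shows "fps_const 1 * MO_term [k] ^ 1 = inflate k (\<lambda>x. x)"
    and "fps_const 6 * MO_term [k] ^ 2 = inflate k (\<lambda>x. x ^ 3 - x)"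
    and "fps_const 120 * MO_term [k] ^ 3 = inflate k (\<lambda>x. x ^ 5 - 5 * x ^ 3 + 4 * x)"
    and "fps_const 5040 * MO_term [k] ^ 4 = inflate k (\<lambda>x. x ^ 7 - 14 * x ^ 5
        + 49 * x ^ 3 - 36 * x)"
    and "fps_const 362880 * MO_term [k] ^ 5 =
      inflate k (\<lambda>x. x ^ 9 - 30 * x ^ 7 + 273 * x ^ 5 - 820 * x ^ 3 + 576 * x)"
proof -
  show 1: "fps_const 1 * MO_term [k] ^ 1 = inflate k (\<lambda>x. x)"
    using MO_term_singleton[OF assms] by simp
  have "fps_const (6 * 1) * MO_term [k] ^ Suc 1 = inflate k (\<lambda>x. x ^ 3 - x)"
    by (rule MO_term_singleton_power_Suc[OF assms 1]) (simp_all, algebra)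
  then show 2: "fps_const 6 * MO_term [k] ^ 2 = inflate k (\<lambda>x. x ^ 3 - x)"
    by (simp add: numeral_eq_Suc)
  have "fps_const (20 * 6) * MO_term [k] ^ Suc 2 = inflate k (\<lambda>x. x ^ 5 - 5 * x ^ 3 + 4 * x)"
    by (rule MO_term_singleton_power_Suc[OF assms 2]) (simp_all, algebra)
  then show 3: "fps_const 120 * MO_term [k] ^ 3 = inflate k (\<lambda>x. x ^ 5 - 5 * x ^ 3 + 4 * x)"
    by simp
  have "fps_const (42 * 120) * MO_term [k] ^ Suc 3 =
      inflate k (\<lambda>x. x ^ 7 - 14 * x ^ 5 + 49 * x ^ 3 - 36 * x)"
    by (rule MO_term_singleton_power_Suc[OF assms 3]) (simp_all, algebra)
  then show 4: "fps_const 5040 * MO_term [k] ^ 4 =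
      inflate k (\<lambda>x. x ^ 7 - 14 * x ^ 5 + 49 * x ^ 3 - 36 * x)"
    by simp
  have "fps_const (72 * 5040) * MO_term [k] ^ Suc 4 =
      inflate k (\<lambda>x. x ^ 9 - 30 * x ^ 7 + 273 * x ^ 5 - 820 * x ^ 3 + 576 * x)"
    by (rule MO_term_singleton_power_Suc[OF assms 4]) (simp_all, algebra)
  then show "fps_const 362880 * MO_term [k] ^ 5 =
      inflate k (\<lambda>x. x ^ 9 - 30 * x ^ 7 + 273 * x ^ 5 - 820 * x ^ 3 + 576 * x)"
    by simp
qed

lemma MO_power_sums:
  "MO_power_sum 1 = sigma_fps 1"
  "6 * MO_power_sum 2 = sigma_fps 3 - sigma_fps 1"
  "120 * MO_power_sum 3 = sigma_fps 5 - 5 * sigma_fps 3 + 4 * sigma_fps 1"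
  "5040 * MO_power_sum 4 = sigma_fps 7 - 14 * sigma_fps 5 + 49 * sigma_fps 3 - 36 * sigma_fps 1"
  "362880 * MO_power_sum 5 =
     sigma_fps 9 - 30 * sigma_fps 7 + 273 * sigma_fps 5 - 820 * sigma_fps 3 + 576 * sigma_fps 1"
  using MO_term_singleton_powers[THEN MO_power_sum_eq_divisor_fps]
  by (simp_all add: numeral_fps_const sigma_fps_def fps_eq_iff divisor_fps_def sum.distrib
      sum_subtractf
    sum_distrib_left)

subsection \<open>Eisenstein series\<close>

lemma fps_XD_mult: "fps_XD (f * g) = f * fps_XD g + fps_XD f * (g :: 'a::comm_ring_1 fps)"
  by (simp add: fps_XD_def algebra_simps)

lemma fps_XD_diff: "fps_XD (f - g) = fps_XD f - fps_XD (g :: 'a::comm_ring_1 fps)"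
  by (simp add: fps_XD_def algebra_simps)

lemma fps_XD_numeral: "fps_XD (numeral k :: 'a::comm_ring_1 fps) = 0"
  by (simp add: fps_XD_def)

lemma fps_XD_1: "fps_XD (1 :: 'a::comm_ring_1 fps) = 0"
  by (simp add: fps_XD_def)

lemma fps_XD_power: "fps_XD (f ^ n) = of_nat n * f ^ (n - 1) * fps_XD (f :: 'a::comm_ring_1 fps)"
  by (simp add: fps_XD_def fps_deriv_power fps_of_nat mult_ac)

lemmas fps_XD_rules = fps_XD_add fps_XD_mult fps_XD_diff fps_XD_numeral fps_XD_1 fps_XD_power

lemma numeral_mult_fps_cancel: "(numeral k * f = numeral k * g) = (f = (g :: int fps))"
  by (auto simp: fps_eq_iff numeral_mult_fps_nth)

text \<open>The normalised Eisenstein series, taken as formal power series: the relations among them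
  are derived from the convolution identities, not from modularity.\<close>

definition E2 :: "int fps" where "E2 = 1 - 24 * sigma_fps 1"
definition E4 :: "int fps" where "E4 = 1 + 240 * sigma_fps 3"
definition E6 :: "int fps" where "E6 = 1 - 504 * sigma_fps 5"

lemma sigma_1_eisenstein: "24 * sigma_fps 1 = 1 - E2"
  and sigma_3_eisenstein: "240 * sigma_fps 3 = E4 - 1"
  and sigma_5_eisenstein: "504 * sigma_fps 5 = 1 - E6"
  by (simp_all add: E2_def E4_def E6_def)

text \<open>Together with \<open>sigma_9_eisenstein\<close> this expresses E8 and E10 by
  \<open>E4\<close> and \<open>E6\<close>, so that three series generate everything needed.\<close>

lemma sigma_7_eisenstein: "480 * sigma_fps 7 = E4 ^ 2 - 1"
  using sigma_3_3 unfolding E4_def by algebra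

lemma sigma_9_eisenstein: "264 * sigma_fps 9 = 1 - E4 * E6"
  using sigma_3_5 unfolding E4_def E6_def by algebra

lemmas sigma_eisenstein =
  sigma_1_eisenstein sigma_3_eisenstein sigma_5_eisenstein sigma_7_eisenstein sigma_9_eisenstein

text \<open>The first of Ramanujan's three differential equations. The common factor 12 keeps all
  coefficients integral.\<close>

lemma fps_XD_E2: "12 * fps_XD E2 = E2 ^ 2 - E4"
proof -
  have "12 * fps_XD E2 = - 48 * (6 * fps_XD (sigma_fps 1))"
    by (simp add: E2_def fps_XD_rules)
  then show ?thesis using sigma_1_1 unfolding E2_def E4_def by algebra
qed

lemma fps_XD_E4: "12 * fps_XD E4 = 4 * E2 * E4 - 4 * E6"
proof -
  have "12 * fps_XD E4 = 96 * (30 * fps_XD (sigma_fps 3))"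
    by (simp add: E4_def fps_XD_rules)
  then show ?thesis using sigma_1_3 unfolding E2_def E4_def E6_def by algebra
qed

lemma fps_XD_E6: "12 * fps_XD E6 = 6 * E2 * E6 - 6 * E4 ^ 2"
proof -
  \<comment> \<open>The extra factor 10 produces the multiple 420 of the derivative that occurs in
    \<open>sigma_1_5_3_3\<close>; it is cancelled at the end.\<close>
  have "10 * (12 * fps_XD E6) = - 144 * (420 * fps_XD (sigma_fps 5))"
    by (simp add: E6_def fps_XD_rules)
  then have "10 * (12 * fps_XD E6) = 10 * (6 * E2 * E6 - 6 * E4 ^ 2)"
    using sigma_1_5_3_3 sigma_3_3 unfolding E2_def E4_def E6_def by algebra
  then show ?thesis by (simp only: numeral_mult_fps_cancel)
qed

section \<open>Derivatives of the divisor sum series in terms of Eisenstein series\<close>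

text \<open>The pattern of this lemma and the next nine: differentiate the preceding expression,
  then eliminate the derivatives by Ramanujan's equations. Each derivative multiplies the scaling
  factor by 12.\<close>

lemma fps_XD1_sigma_1:
  "288 * fps_XD (sigma_fps 1) = E4 - E2 ^ 2"
proof -
  have "24 * fps_XD (sigma_fps 1) = fps_XD (24 * sigma_fps 1)"
    by (simp add: fps_XD_rules)
  also have "\<dots> = (-1) * fps_XD E2"
    unfolding sigma_1_eisenstein by (simp add: fps_XD_rules algebra_simps)
  finally have *: "24 * fps_XD (sigma_fps 1) = (-1) * fps_XD E2" .
  have "288 * fps_XD (sigma_fps 1) = 12 * (24 * fps_XD (sigma_fps 1))"
    by simp
  also have "\<dots> = (-1) * (12 * fps_XD E2)"
    unfolding * by algebra
  also have "\<dots> = E4 - E2 ^ 2"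
    unfolding fps_XD_E2 fps_XD_E4 fps_XD_E6 by algebra
  finally show ?thesis .
qed

lemma fps_XD2_sigma_1:
  "3456 * fps_XD (fps_XD (sigma_fps 1)) = 6 * E2 * E4 - 2 * E2 ^ 3 - 4 * E6"
proof -
  have "288 * fps_XD (fps_XD (sigma_fps 1)) = fps_XD (288 * fps_XD (sigma_fps 1))"
    by (simp add: fps_XD_rules)
  also have "\<dots> = (-2 * E2) * fps_XD E2 + (1) * fps_XD E4"
    unfolding fps_XD1_sigma_1 by (simp add: fps_XD_rules algebra_simps)
  finally have *: "288 * fps_XD (fps_XD (sigma_fps 1)) = (-2 * E2) * fps_XD E2 + (1) * fps_XD E4" .
  have "3456 * fps_XD (fps_XD (sigma_fps 1)) = 12 * (288 * fps_XD (fps_XD (sigma_fps 1)))"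
    by simp
  also have "\<dots> = (-2 * E2) * (12 * fps_XD E2) + (1) * (12 * fps_XD E4)"
    unfolding * by algebra
  also have "\<dots> = 6 * E2 * E4 - 2 * E2 ^ 3 - 4 * E6"
    unfolding fps_XD_E2 fps_XD_E4 fps_XD_E6 by algebra
  finally show ?thesis .
qed

lemma fps_XD3_sigma_1:
  "41472 * fps_XD (fps_XD (fps_XD (sigma_fps 1))) = 36 * E2 ^ 2 * E4 - 6 * E2 ^ 4 - 48 * E2 * E6
      + 18 * E4 ^ 2"
proof -
  have "3456 * fps_XD (fps_XD (fps_XD (sigma_fps 1)))
      = fps_XD (3456 * fps_XD (fps_XD (sigma_fps 1)))"
    by (simp add: fps_XD_rules)
  also have "\<dots> = (6 * E4 - 6 * E2 ^ 2) * fps_XD E2 + (6 * E2) * fps_XD E4 + (-4) * fps_XD E6"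
    unfolding fps_XD2_sigma_1 by (simp add: fps_XD_rules algebra_simps)
  finally have *: "3456 * fps_XD (fps_XD (fps_XD (sigma_fps 1))) = (6 * E4
      - 6 * E2 ^ 2) * fps_XD E2 + (6 * E2) * fps_XD E4 + (-4) * fps_XD E6" .
  have "41472 * fps_XD (fps_XD (fps_XD (sigma_fps 1)))
      = 12 * (3456 * fps_XD (fps_XD (fps_XD (sigma_fps 1))))"
    by simp
  also have "\<dots> = (6 * E4 - 6 * E2 ^ 2) * (12 * fps_XD E2) + (6 * E2) * (12 * fps_XD E4)
      + (-4) * (12 * fps_XD E6)"
    unfolding * by algebra
  also have "\<dots> = 36 * E2 ^ 2 * E4 - 6 * E2 ^ 4 - 48 * E2 * E6 + 18 * E4 ^ 2"
    unfolding fps_XD_E2 fps_XD_E4 fps_XD_E6 by algebra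
  finally show ?thesis .
qed

lemma fps_XD4_sigma_1:
  "497664 * fps_XD (fps_XD (fps_XD (fps_XD (sigma_fps 1)))) = 240 * E2 ^ 3 * E4 - 24 * E2 ^ 5
      - 480 * E2 ^ 2 * E6 + 360 * E2 * E4 ^ 2 - 96 * E4 * E6"
proof -
  have "41472 * fps_XD (fps_XD (fps_XD (fps_XD (sigma_fps 1))))
      = fps_XD (41472 * fps_XD (fps_XD (fps_XD (sigma_fps 1))))"
    by (simp add: fps_XD_rules)
  also have "\<dots> = (72 * E2 * E4 - 24 * E2 ^ 3 - 48 * E6) * fps_XD E2 + (36 * E2 ^ 2
      + 36 * E4) * fps_XD E4 + (-48 * E2) * fps_XD E6"
    unfolding fps_XD3_sigma_1 by (simp add: fps_XD_rules algebra_simps)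
  finally have *: "41472 * fps_XD (fps_XD (fps_XD (fps_XD (sigma_fps 1)))) = (72 * E2 * E4
      - 24 * E2 ^ 3 - 48 * E6) * fps_XD E2 + (36 * E2 ^ 2 + 36 * E4) * fps_XD E4
      + (-48 * E2) * fps_XD E6" .
  have "497664 * fps_XD (fps_XD (fps_XD (fps_XD (sigma_fps 1))))
      = 12 * (41472 * fps_XD (fps_XD (fps_XD (fps_XD (sigma_fps 1)))))"
    by simp
  also have "\<dots> = (72 * E2 * E4 - 24 * E2 ^ 3 - 48 * E6) * (12 * fps_XD E2) + (36 * E2 ^ 2
      + 36 * E4) * (12 * fps_XD E4) + (-48 * E2) * (12 * fps_XD E6)"
    unfolding * by algebra
  also have "\<dots> = 240 * E2 ^ 3 * E4 - 24 * E2 ^ 5 - 480 * E2 ^ 2 * E6 + 360 * E2 * E4 ^ 2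
      - 96 * E4 * E6"
    unfolding fps_XD_E2 fps_XD_E4 fps_XD_E6 by algebra
  finally show ?thesis .
qed

lemma fps_XD1_sigma_3:
  "2880 * fps_XD (sigma_fps 3) = 4 * E2 * E4 - 4 * E6"
proof -
  have "240 * fps_XD (sigma_fps 3) = fps_XD (240 * sigma_fps 3)"
    by (simp add: fps_XD_rules)
  also have "\<dots> = (1) * fps_XD E4"
    unfolding sigma_3_eisenstein by (simp add: fps_XD_rules algebra_simps)
  finally have *: "240 * fps_XD (sigma_fps 3) = (1) * fps_XD E4" .
  have "2880 * fps_XD (sigma_fps 3) = 12 * (240 * fps_XD (sigma_fps 3))"
    by simp
  also have "\<dots> = (1) * (12 * fps_XD E4)"
    unfolding * by algebra
  also have "\<dots> = 4 * E2 * E4 - 4 * E6"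
    unfolding fps_XD_E2 fps_XD_E4 fps_XD_E6 by algebra
  finally show ?thesis .
qed

lemma fps_XD2_sigma_3:
  "34560 * fps_XD (fps_XD (sigma_fps 3)) = 20 * E2 ^ 2 * E4 - 40 * E2 * E6 + 20 * E4 ^ 2"
proof -
  have "2880 * fps_XD (fps_XD (sigma_fps 3)) = fps_XD (2880 * fps_XD (sigma_fps 3))"
    by (simp add: fps_XD_rules)
  also have "\<dots> = (4 * E4) * fps_XD E2 + (4 * E2) * fps_XD E4 + (-4) * fps_XD E6"
    unfolding fps_XD1_sigma_3 by (simp add: fps_XD_rules algebra_simps)
  finally have *: "2880 * fps_XD (fps_XD (sigma_fps 3)) = (4 * E4) * fps_XD E2
      + (4 * E2) * fps_XD E4 + (-4) * fps_XD E6" .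
  have "34560 * fps_XD (fps_XD (sigma_fps 3)) = 12 * (2880 * fps_XD (fps_XD (sigma_fps 3)))"
    by simp
  also have "\<dots> = (4 * E4) * (12 * fps_XD E2) + (4 * E2) * (12 * fps_XD E4)
      + (-4) * (12 * fps_XD E6)"
    unfolding * by algebra
  also have "\<dots> = 20 * E2 ^ 2 * E4 - 40 * E2 * E6 + 20 * E4 ^ 2"
    unfolding fps_XD_E2 fps_XD_E4 fps_XD_E6 by algebra
  finally show ?thesis .
qed

lemma fps_XD3_sigma_3:
  "414720 * fps_XD (fps_XD (fps_XD (sigma_fps 3))) = 120 * E2 ^ 3 * E4 - 360 * E2 ^ 2 * E6
      + 360 * E2 * E4 ^ 2 - 120 * E4 * E6"
proof -
  have "34560 * fps_XD (fps_XD (fps_XD (sigma_fps 3)))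
      = fps_XD (34560 * fps_XD (fps_XD (sigma_fps 3)))"
    by (simp add: fps_XD_rules)
  also have "\<dots> = (40 * E2 * E4 - 40 * E6) * fps_XD E2 + (20 * E2 ^ 2 + 40 * E4) * fps_XD E4
      + (-40 * E2) * fps_XD E6"
    unfolding fps_XD2_sigma_3 by (simp add: fps_XD_rules algebra_simps)
  finally have *: "34560 * fps_XD (fps_XD (fps_XD (sigma_fps 3))) = (40 * E2 * E4
      - 40 * E6) * fps_XD E2 + (20 * E2 ^ 2 + 40 * E4) * fps_XD E4 + (-40 * E2) * fps_XD E6" .
  have "414720 * fps_XD (fps_XD (fps_XD (sigma_fps 3)))
      = 12 * (34560 * fps_XD (fps_XD (fps_XD (sigma_fps 3))))"
    by simp
  also have "\<dots> = (40 * E2 * E4 - 40 * E6) * (12 * fps_XD E2) + (20 * E2 ^ 2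
      + 40 * E4) * (12 * fps_XD E4) + (-40 * E2) * (12 * fps_XD E6)"
    unfolding * by algebra
  also have "\<dots> = 120 * E2 ^ 3 * E4 - 360 * E2 ^ 2 * E6 + 360 * E2 * E4 ^ 2 - 120 * E4 * E6"
    unfolding fps_XD_E2 fps_XD_E4 fps_XD_E6 by algebra
  finally show ?thesis .
qed

lemma fps_XD1_sigma_5:
  "6048 * fps_XD (sigma_fps 5) = 6 * E4 ^ 2 - 6 * E2 * E6"
proof -
  have "504 * fps_XD (sigma_fps 5) = fps_XD (504 * sigma_fps 5)"
    by (simp add: fps_XD_rules)
  also have "\<dots> = (-1) * fps_XD E6"
    unfolding sigma_5_eisenstein by (simp add: fps_XD_rules algebra_simps)
  finally have *: "504 * fps_XD (sigma_fps 5) = (-1) * fps_XD E6" .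
  have "6048 * fps_XD (sigma_fps 5) = 12 * (504 * fps_XD (sigma_fps 5))"
    by simp
  also have "\<dots> = (-1) * (12 * fps_XD E6)"
    unfolding * by algebra
  also have "\<dots> = 6 * E4 ^ 2 - 6 * E2 * E6"
    unfolding fps_XD_E2 fps_XD_E4 fps_XD_E6 by algebra
  finally show ?thesis .
qed

lemma fps_XD2_sigma_5:
  "72576 * fps_XD (fps_XD (sigma_fps 5)) = 84 * E2 * E4 ^ 2 - 42 * E2 ^ 2 * E6 - 42 * E4 * E6"
proof -
  have "6048 * fps_XD (fps_XD (sigma_fps 5)) = fps_XD (6048 * fps_XD (sigma_fps 5))"
    by (simp add: fps_XD_rules)
  also have "\<dots> = (-6 * E6) * fps_XD E2 + (12 * E4) * fps_XD E4 + (-6 * E2) * fps_XD E6"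
    unfolding fps_XD1_sigma_5 by (simp add: fps_XD_rules algebra_simps)
  finally have *: "6048 * fps_XD (fps_XD (sigma_fps 5)) = (-6 * E6) * fps_XD E2
      + (12 * E4) * fps_XD E4 + (-6 * E2) * fps_XD E6" .
  have "72576 * fps_XD (fps_XD (sigma_fps 5)) = 12 * (6048 * fps_XD (fps_XD (sigma_fps 5)))"
    by simp
  also have "\<dots> = (-6 * E6) * (12 * fps_XD E2) + (12 * E4) * (12 * fps_XD E4)
      + (-6 * E2) * (12 * fps_XD E6)"
    unfolding * by algebra
  also have "\<dots> = 84 * E2 * E4 ^ 2 - 42 * E2 ^ 2 * E6 - 42 * E4 * E6"
    unfolding fps_XD_E2 fps_XD_E4 fps_XD_E6 by algebra
  finally show ?thesis .
qed

lemma fps_XD1_sigma_7: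
  "5760 * fps_XD (sigma_fps 7) = 8 * E2 * E4 ^ 2 - 8 * E4 * E6"
proof -
  have "480 * fps_XD (sigma_fps 7) = fps_XD (480 * sigma_fps 7)"
    by (simp add: fps_XD_rules)
  also have "\<dots> = (2 * E4) * fps_XD E4"
    unfolding sigma_7_eisenstein by (simp add: fps_XD_rules algebra_simps)
  finally have *: "480 * fps_XD (sigma_fps 7) = (2 * E4) * fps_XD E4" .
  have "5760 * fps_XD (sigma_fps 7) = 12 * (480 * fps_XD (sigma_fps 7))"
    by simp
  also have "\<dots> = (2 * E4) * (12 * fps_XD E4)"
    unfolding * by algebra
  also have "\<dots> = 8 * E2 * E4 ^ 2 - 8 * E4 * E6"
    unfolding fps_XD_E2 fps_XD_E4 fps_XD_E6 by algebra
  finally show ?thesis .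
qed

lemmas fps_XD_sigma_eisenstein =
  fps_XD1_sigma_1 fps_XD2_sigma_1 fps_XD3_sigma_1 fps_XD4_sigma_1 fps_XD1_sigma_3
  fps_XD2_sigma_3 fps_XD3_sigma_3 fps_XD1_sigma_5 fps_XD2_sigma_5 fps_XD1_sigma_7

section \<open>The series MO as polynomials in the Eisenstein series\<close>

lemma MO_power_sums_eisenstein:
  shows "24 * MO_power_sum 1 = 1 - E2"
    "1440 * MO_power_sum 2 = 10 * E2 + E4 - 11"
    "120960 * MO_power_sum 3 = 191 - 168 * E2 - 21 * E4 - 2 * E6"
    "7257600 * MO_power_sum 4 = 2160 * E2 + 3 * E4 ^ 2 + 294 * E4 + 40 * E6 - 2497"
    "191600640 * MO_power_sum 5 = 14797 - 12672 * E2 - 33 * E4 ^ 2 - 2 * E4 * E6 - 1804 * E4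
        - 286 * E6"
proof -
  show "24 * MO_power_sum 1 = 1 - E2"
    unfolding MO_power_sums by (rule sigma_eisenstein)
  have "1440 * MO_power_sum 2 = 240 * (6 * MO_power_sum 2)"
    by simp
  also have "\<dots> = (240 * sigma_fps 3) - 10 * (24 * sigma_fps 1)"
    unfolding MO_power_sums by algebra
  also have "\<dots> = 10 * E2 + E4 - 11"
    unfolding sigma_eisenstein by algebra
  finally show "1440 * MO_power_sum 2 = 10 * E2 + E4 - 11" .
  have "120960 * MO_power_sum 3 = 1008 * (120 * MO_power_sum 3)"
    by simp
  also have "\<dots> = 2 * (504 * sigma_fps 5) - 21 * (240 * sigma_fps 3) + 168 * (24 * sigma_fps 1)"
    unfolding MO_power_sums by algebra
  also have "\<dots> = 191 - 168 * E2 - 21 * E4 - 2 * E6"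
    unfolding sigma_eisenstein by algebra
  finally show "120960 * MO_power_sum 3 = 191 - 168 * E2 - 21 * E4 - 2 * E6" .
  have "7257600 * MO_power_sum 4 = 1440 * (5040 * MO_power_sum 4)"
    by simp
  also have "\<dots> = 3 * (480 * sigma_fps 7) - 40 * (504 * sigma_fps 5)
      + 294 * (240 * sigma_fps 3) - 2160 * (24 * sigma_fps 1)"
    unfolding MO_power_sums by algebra
  also have "\<dots> = 2160 * E2 + 3 * E4 ^ 2 + 294 * E4 + 40 * E6 - 2497"
    unfolding sigma_eisenstein by algebra
  finally show "7257600 * MO_power_sum 4 = 2160 * E2 + 3 * E4 ^ 2 + 294 * E4 + 40 * E6 - 2497" .
  have "191600640 * MO_power_sum 5 = 528 * (362880 * MO_power_sum 5)"
    by simp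
  also have "\<dots> = 2 * (264 * sigma_fps 9) - 33 * (480 * sigma_fps 7)
      + 286 * (504 * sigma_fps 5) - 1804 * (240 * sigma_fps 3) + 12672 * (24 * sigma_fps 1)"
    unfolding MO_power_sums by algebra
  also have "\<dots> = 14797 - 12672 * E2 - 33 * E4 ^ 2 - 2 * E4 * E6 - 1804 * E4 - 286 * E6"
    unfolding sigma_eisenstein by algebra
  finally show "191600640 * MO_power_sum 5 = 14797 - 12672 * E2 - 33 * E4 ^ 2 - 2 * E4 * E6
      - 1804 * E4 - 286 * E6" .
qed

text \<open>Newton's identities are solved successively, all over the integers: every series is
  carried with a multiple for which its Eisenstein polynomial has integer coefficients.\<close>

lemma MO_series_eisenstein:
  shows "24 * MO_series 1 = 1 - E2"
    "5760 * MO_series 2 = 5 * E2 ^ 2 - 30 * E2 - 2 * E4 + 27"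
    "2903040 * MO_series 3 = 525 * E2 ^ 2 - 35 * E2 ^ 3 + 42 * E2 * E4 - 2331 * E2 - 210 * E4
        - 16 * E6 + 2025"
    "1393459200 * MO_series 4 = 175 * E2 ^ 4 - 4900 * E2 ^ 3 - 420 * E2 ^ 2 * E4 + 49350 * E2 ^ 2
        + 5880 * E2 * E4 + 320 * E2 * E6 - 193740 * E2 - 60 * E4 ^ 2 - 19740 * E4 - 2240 * E6
        + 165375"
    "1839366144000 * MO_series 5 = 86625 * E2 ^ 4 - 1925 * E2 ^ 5 + 7700 * E2 ^ 3 * E4
        - 1536150 * E2 ^ 3 - 207900 * E2 ^ 2 * E4 - 8800 * E2 ^ 2 * E6 + 12960750 * E2 ^ 2
        + 3300 * E2 * E4 ^ 2 + 1843380 * E2 * E4 + 158400 * E2 * E6 - 47574945 * E2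
        - 29700 * E4 ^ 2 - 320 * E4 * E6 - 5184300 * E4 - 702240 * E6 + 40186125"
proof -
  have Newton: "MO_series 1 = MO_power_sum 1"
    "2 * MO_series 2 = (MO_series 1 * MO_power_sum 1) - MO_power_sum 2"
    "3 * MO_series 3 = (MO_series 2 * MO_power_sum 1) - (MO_series 1 * MO_power_sum 2)
        + MO_power_sum 3"
    "4 * MO_series 4 = (MO_series 3 * MO_power_sum 1) - (MO_series 2 * MO_power_sum 2)
        + (MO_series 1 * MO_power_sum 3) - MO_power_sum 4"
    "5 * MO_series 5 = (MO_series 4 * MO_power_sum 1) - (MO_series 3 * MO_power_sum 2)
        + (MO_series 2 * MO_power_sum 3) - (MO_series 1 * MO_power_sum 4) + MO_power_sum 5"
    using MO_series_Newton[of 0] MO_series_Newton[of 1] MO_series_Newton[of 2]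
      MO_series_Newton[of 3] MO_series_Newton[of 4]
    by (simp_all add: MO_series_0 numeral_eq_Suc)
  show e1: "24 * MO_series 1 = 1 - E2"
    unfolding Newton by (rule MO_power_sums_eisenstein)
  have "5760 * MO_series 2 = 2880 * (2 * MO_series 2)"
    by simp
  \<comment> \<open>Since 2880 = 5 * 24 * 24 = 2 * 1440, each series appears with exactly the
    multiple for which its expression is known. The later cases are arranged in the same
    way.\<close>
  also have "\<dots> = 5 * ((24 * MO_series 1) * (24 * MO_power_sum 1)) - 2 * (1440 * MO_power_sum 2)"
    unfolding Newton by algebra
  also have "\<dots> = 5 * E2 ^ 2 - 30 * E2 - 2 * E4 + 27"
    unfolding MO_power_sums_eisenstein e1 by algebra
  finally show e2: "5760 * MO_series 2 = 5 * E2 ^ 2 - 30 * E2 - 2 * E4 + 27" .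
  have "2903040 * MO_series 3 = 967680 * (3 * MO_series 3)"
    by simp
  also have "\<dots> = 7 * ((5760 * MO_series 2) * (24 * MO_power_sum 1))
      - 28 * ((24 * MO_series 1) * (1440 * MO_power_sum 2)) + 8 * (120960 * MO_power_sum 3)"
    unfolding Newton by algebra
  also have "\<dots> = 525 * E2 ^ 2 - 35 * E2 ^ 3 + 42 * E2 * E4 - 2331 * E2 - 210 * E4 - 16 * E6 + 2025"
    unfolding MO_power_sums_eisenstein e1 e2 by algebra
  finally show e3: "2903040 * MO_series 3 = 525 * E2 ^ 2 - 35 * E2 ^ 3 + 42 * E2 * E4 - 2331 * E2
      - 210 * E4 - 16 * E6 + 2025" .
  have "1393459200 * MO_series 4 = 348364800 * (4 * MO_series 4)"
    by simp
  also have "\<dots> = 5 * ((2903040 * MO_series 3) * (24 * MO_power_sum 1))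
      - 42 * ((5760 * MO_series 2) * (1440 * MO_power_sum 2))
      + 120 * ((24 * MO_series 1) * (120960 * MO_power_sum 3)) - 48 * (7257600 * MO_power_sum 4)"
    unfolding Newton by algebra
  also have "\<dots> = 175 * E2 ^ 4 - 4900 * E2 ^ 3 - 420 * E2 ^ 2 * E4 + 49350 * E2 ^ 2
      + 5880 * E2 * E4 + 320 * E2 * E6 - 193740 * E2 - 60 * E4 ^ 2 - 19740 * E4 - 2240 * E6
      + 165375"
    unfolding MO_power_sums_eisenstein e1 e2 e3 by algebra
  finally show e4: "1393459200 * MO_series 4 = 175 * E2 ^ 4 - 4900 * E2 ^ 3 - 420 * E2 ^ 2 * E4
      + 49350 * E2 ^ 2 + 5880 * E2 * E4 + 320 * E2 * E6 - 193740 * E2 - 60 * E4 ^ 2 - 19740 * E4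
      - 2240 * E6 + 165375" .
  have "1839366144000 * MO_series 5 = 367873228800 * (5 * MO_series 5)"
    by simp
  also have "\<dots> = 11 * ((1393459200 * MO_series 4) * (24 * MO_power_sum 1))
      - 88 * ((2903040 * MO_series 3) * (1440 * MO_power_sum 2))
      + 528 * ((5760 * MO_series 2) * (120960 * MO_power_sum 3))
      - 2112 * ((24 * MO_series 1) * (7257600 * MO_power_sum 4))
      + 1920 * (191600640 * MO_power_sum 5)"
    unfolding Newton by algebra
  also have "\<dots> = 86625 * E2 ^ 4 - 1925 * E2 ^ 5 + 7700 * E2 ^ 3 * E4 - 1536150 * E2 ^ 3
      - 207900 * E2 ^ 2 * E4 - 8800 * E2 ^ 2 * E6 + 12960750 * E2 ^ 2 + 3300 * E2 * E4 ^ 2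
      + 1843380 * E2 * E4 + 158400 * E2 * E6 - 47574945 * E2 - 29700 * E4 ^ 2 - 320 * E4 * E6
      - 5184300 * E4 - 702240 * E6 + 40186125"
    unfolding MO_power_sums_eisenstein e1 e2 e3 e4 by algebra
  finally show e5: "1839366144000 * MO_series 5 = 86625 * E2 ^ 4 - 1925 * E2 ^ 5
      + 7700 * E2 ^ 3 * E4 - 1536150 * E2 ^ 3 - 207900 * E2 ^ 2 * E4 - 8800 * E2 ^ 2 * E6
      + 12960750 * E2 ^ 2 + 3300 * E2 * E4 ^ 2 + 1843380 * E2 * E4 + 158400 * E2 * E6
      - 47574945 * E2 - 29700 * E4 ^ 2 - 320 * E4 * E6 - 5184300 * E4 - 702240 * E6 + 40186125" .
qed

section \<open>Divisor sum formulas for N times MO\<close>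

text \<open>The factor 8 is \<open>N 2\<close>, and the next three lemmas have \<open>N 3\<close>,
  \<open>N 4\<close> and \<open>N 5\<close>. The coefficients come from matching monomials: E2^2,
  for instance, occurs only in the derivative of \<open>sigma_fps 1\<close>. The constants
  cancel.\<close>

lemma MO_series_2:
  "8 * MO_series 2 = sigma_fps 1 - 2 * fps_XD (sigma_fps 1) + sigma_fps 3"
proof -
  have "1440 * (8 * MO_series 2) = 2 * (5760 * MO_series 2)"
    by simp
  also have "\<dots> = 10 * E2 ^ 2 - 60 * E2 - 4 * E4 + 54"
    unfolding MO_series_eisenstein by algebra
  also have "\<dots> = 60 * (24 * sigma_fps 1) - 10 * (288 * fps_XD (sigma_fps 1))
      + 6 * (240 * sigma_fps 3)"
    unfolding sigma_eisenstein fps_XD_sigma_eisenstein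
    by algebra
  also have "\<dots> = 1440 * (sigma_fps 1 - 2 * fps_XD (sigma_fps 1) + sigma_fps 3)"
    by (simp add: algebra_simps)
  finally show ?thesis
    by (simp only: numeral_mult_fps_cancel)
qed

lemma MO_series_3:
  "1920 * MO_series 3 = 37 * sigma_fps 1 - 100 * fps_XD (sigma_fps 1)
      + 40 * fps_XD (fps_XD (sigma_fps 1)) + 50 * sigma_fps 3 - 30 * fps_XD (sigma_fps 3)
      + 3 * sigma_fps 5"
proof -
  have "120960 * (1920 * MO_series 3) = 80 * (2903040 * MO_series 3)"
    by simp
  also have "\<dots> = 42000 * E2 ^ 2 - 2800 * E2 ^ 3 + 3360 * E2 * E4 - 186480 * E2 - 16800 * E4
      - 1280 * E6 + 162000"
    unfolding MO_series_eisenstein by algebra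
  also have "\<dots> = 186480 * (24 * sigma_fps 1) - 42000 * (288 * fps_XD (sigma_fps 1))
      + 1400 * (3456 * fps_XD (fps_XD (sigma_fps 1))) + 25200 * (240 * sigma_fps 3)
      - 1260 * (2880 * fps_XD (sigma_fps 3)) + 720 * (504 * sigma_fps 5)"
    unfolding sigma_eisenstein fps_XD_sigma_eisenstein
    by algebra
  also have "\<dots> = 120960 * (37 * sigma_fps 1 - 100 * fps_XD (sigma_fps 1)
      + 40 * fps_XD (fps_XD (sigma_fps 1)) + 50 * sigma_fps 3 - 30 * fps_XD (sigma_fps 3)
      + 3 * sigma_fps 5)"
    by (simp add: algebra_simps)
  finally show ?thesis
    by (simp only: numeral_mult_fps_cancel)
qed

lemma MO_series_4:
  "967680 * MO_series 4 = 3229 * sigma_fps 1 - 9870 * fps_XD (sigma_fps 1)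
      + 5880 * fps_XD (fps_XD (sigma_fps 1)) - 840 * fps_XD (fps_XD (fps_XD (sigma_fps 1)))
      + 4935 * sigma_fps 3 - 4410 * fps_XD (sigma_fps 3) + 756 * fps_XD (fps_XD (sigma_fps 3))
      + 441 * sigma_fps 5 - 126 * fps_XD (sigma_fps 5) + 5 * sigma_fps 7"
proof -
  have "1451520 * (967680 * MO_series 4) = 1008 * (1393459200 * MO_series 4)"
    by simp
  also have "\<dots> = 176400 * E2 ^ 4 - 4939200 * E2 ^ 3 - 423360 * E2 ^ 2 * E4
      + 49744800 * E2 ^ 2 + 5927040 * E2 * E4 + 322560 * E2 * E6 - 195289920 * E2
      - 60480 * E4 ^ 2 - 19897920 * E4 - 2257920 * E6 + 166698000"
    unfolding MO_series_eisenstein by algebra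
  also have "\<dots> = 195289920 * (24 * sigma_fps 1) - 49744800 * (288 * fps_XD (sigma_fps 1))
      + 2469600 * (3456 * fps_XD (fps_XD (sigma_fps 1)))
      - 29400 * (41472 * fps_XD (fps_XD (fps_XD (sigma_fps 1)))) + 29846880 * (240 * sigma_fps 3)
      - 2222640 * (2880 * fps_XD (sigma_fps 3)) + 31752 * (34560 * fps_XD (fps_XD (sigma_fps 3)))
      + 1270080 * (504 * sigma_fps 5) - 30240 * (6048 * fps_XD (sigma_fps 5))
      + 15120 * (480 * sigma_fps 7)"
    unfolding sigma_eisenstein fps_XD_sigma_eisenstein
    by algebra
  also have "\<dots> = 1451520 * (3229 * sigma_fps 1 - 9870 * fps_XD (sigma_fps 1)
      + 5880 * fps_XD (fps_XD (sigma_fps 1)) - 840 * fps_XD (fps_XD (fps_XD (sigma_fps 1)))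
      + 4935 * sigma_fps 3 - 4410 * fps_XD (sigma_fps 3) + 756 * fps_XD (fps_XD (sigma_fps 3))
      + 441 * sigma_fps 5 - 126 * fps_XD (sigma_fps 5) + 5 * sigma_fps 7)"
    by (simp add: algebra_simps)
  finally show ?thesis
    by (simp only: numeral_mult_fps_cancel)
qed

text \<open>The fifteen series on the right match the fifteen nonconstant monomials of weight at
  most 10 in \<open>E2\<close>, \<open>E4\<close> and \<open>E6\<close>.\<close>

lemma MO_series_5:
  "154828800 * MO_series 5 = 96111 * sigma_fps 1 - 314200 * fps_XD (sigma_fps 1)
      + 223440 * fps_XD (fps_XD (sigma_fps 1)) - 50400 * fps_XD (fps_XD (fps_XD (sigma_fps 1)))
      + 3360 * fps_XD (fps_XD (fps_XD (fps_XD (sigma_fps 1)))) + 157100 * sigma_fps 3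
      - 167580 * fps_XD (sigma_fps 3) + 45360 * fps_XD (fps_XD (sigma_fps 3))
      - 3360 * fps_XD (fps_XD (fps_XD (sigma_fps 3))) + 16758 * sigma_fps 5
      - 7560 * fps_XD (sigma_fps 5) + 720 * fps_XD (fps_XD (sigma_fps 5)) + 300 * sigma_fps 7
      - 50 * fps_XD (sigma_fps 7) + sigma_fps 9"
proof -
  have "191600640 * (154828800 * MO_series 5) = 16128 * (1839366144000 * MO_series 5)"
    by simp
  also have "\<dots> = 1397088000 * E2 ^ 4 - 31046400 * E2 ^ 5 + 124185600 * E2 ^ 3 * E4
      - 24775027200 * E2 ^ 3 - 3353011200 * E2 ^ 2 * E4 - 141926400 * E2 ^ 2 * E6
      + 209030976000 * E2 ^ 2 + 53222400 * E2 * E4 ^ 2 + 29730032640 * E2 * E4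
      + 2554675200 * E2 * E6 - 767288712960 * E2 - 479001600 * E4 ^ 2 - 5160960 * E4 * E6
      - 83612390400 * E4 - 11325726720 * E6 + 648121824000"
    unfolding MO_series_eisenstein by algebra
  also have "\<dots> = 767288712960 * (24 * sigma_fps 1)
      - 209030976000 * (288 * fps_XD (sigma_fps 1))
      + 12387513600 * (3456 * fps_XD (fps_XD (sigma_fps 1)))
      - 232848000 * (41472 * fps_XD (fps_XD (fps_XD (sigma_fps 1))))
      + 1293600 * (497664 * fps_XD (fps_XD (fps_XD (fps_XD (sigma_fps 1)))))
      + 125418585600 * (240 * sigma_fps 3) - 11148762240 * (2880 * fps_XD (sigma_fps 3))
      + 251475840 * (34560 * fps_XD (fps_XD (sigma_fps 3)))
      - 1552320 * (414720 * fps_XD (fps_XD (fps_XD (sigma_fps 3))))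
      + 6370721280 * (504 * sigma_fps 5) - 239500800 * (6048 * fps_XD (sigma_fps 5))
      + 1900800 * (72576 * fps_XD (fps_XD (sigma_fps 5))) + 119750400 * (480 * sigma_fps 7)
      - 1663200 * (5760 * fps_XD (sigma_fps 7)) + 725760 * (264 * sigma_fps 9)"
    unfolding sigma_eisenstein fps_XD_sigma_eisenstein
    by algebra
  also have "\<dots> = 191600640 * (96111 * sigma_fps 1 - 314200 * fps_XD (sigma_fps 1)
      + 223440 * fps_XD (fps_XD (sigma_fps 1)) - 50400 * fps_XD (fps_XD (fps_XD (sigma_fps 1)))
      + 3360 * fps_XD (fps_XD (fps_XD (fps_XD (sigma_fps 1)))) + 157100 * sigma_fps 3
      - 167580 * fps_XD (sigma_fps 3) + 45360 * fps_XD (fps_XD (sigma_fps 3))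
      - 3360 * fps_XD (fps_XD (fps_XD (sigma_fps 3))) + 16758 * sigma_fps 5
      - 7560 * fps_XD (sigma_fps 5) + 720 * fps_XD (fps_XD (sigma_fps 5)) + 300 * sigma_fps 7
      - 50 * fps_XD (sigma_fps 7) + sigma_fps 9)"
    by (simp add: algebra_simps)
  finally show ?thesis
    by (simp only: numeral_mult_fps_cancel)
qed

subsection \<open>The congruences\<close>

text \<open>As \<open>p\<close> does not divide \<open>n\<close>, the divisors of \<open>p n\<close>
  are those of \<open>n\<close> and, disjoint from them, their multiples by
  \<open>p\<close>.\<close>

lemma sigma_fps_nth_prime_mult:
  assumes "prime p" "coprime n p" "0 < n"
  shows "sigma_fps k $ (p * n) = (1 + int p ^ k) * sigma_fps k $ n"
proof -
  have p: "0 < p" using assms prime_gt_0_nat by blast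
  have "d dvd p * n \<longleftrightarrow> d dvd n \<or> d \<in> (*) p ` {d. d dvd n}" for d
  proof (cases "p dvd d")
    case True
    then obtain e where "d = p * e" by (auto elim: dvdE)
    then show ?thesis using p by (auto dest: dvd_mult_right)
  next
    case False
    then have "coprime d p" using assms(1) by (metis coprime_commute prime_imp_coprime)
    then have "d dvd p * n \<longleftrightarrow> d dvd n" by (simp add: coprime_dvd_mult_right_iff)
    then show ?thesis using False by auto
  qed
  then have "{d. d dvd p * n} = {d. d dvd n} \<union> (*) p ` {d. d dvd n}" by blast
  moreover have "{d. d dvd n} \<inter> (*) p ` {d. d dvd n} = {}"
    using assms by (auto dest: dvd_mult_left simp: prime_imp_coprime)
  moreover have "inj_on ((*) p) {d. d dvd n}" using p by (simp add: inj_on_def)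
  ultimately have "(\<Sum>d | d dvd p * n. int d ^ k) =
      (\<Sum>d | d dvd n. int d ^ k) + (\<Sum>d | d dvd n. int (p * d) ^ k)"
    using assms by (simp add: sum.union_disjoint sum.reindex)
  also have "\<dots> = (1 + int p ^ k) * (\<Sum>d | d dvd n. int d ^ k)"
    by (simp add: power_mult_distrib distrib_right sum_distrib_left sum.distrib)
  finally show ?thesis
    using assms p by (simp flip: divisor_sum_eq_sigma_fps)
qed

text \<open>For odd \<open>k\<close> the factor 1 + p^k is congruent to 1 + (-1)^k = 0.\<close>

lemma dvd_sigma_fps_nth_prime_mult:
  assumes "prime p" "coprime n p" "0 < n" "[int p = -1] (mod m)" "odd k"
  shows "m dvd sigma_fps k $ (p * n)"
proof -
  have "[int p ^ k = (-1) ^ k] (mod m)"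
    using assms(4) by (rule cong_pow)
  then have "m dvd 1 + int p ^ k"
    using \<open>odd k\<close> by (simp add: cong_iff_dvd_diff add.commute)
  then show ?thesis
    using assms by (simp add: sigma_fps_nth_prime_mult)
qed

text \<open>Since \<open>fps_XD\<close> multiplies each coefficient by its index, every summand in
  the formulas for \<open>N a\<close> times the series is, at index \<open>p * n\<close>, an integer
  multiple of a coefficient of \<open>sigma_fps k\<close> with odd k.\<close>

lemma dvd_N_mult_MO_prime_mult:
  assumes a: "a \<in> {2, 3, 4, 5}"
    and p: "prime p" "coprime n p" "0 < n" "[int p = -1] (mod m)"
  shows "m dvd int (N a) * MO a (p * n)"
proof -
  have sigma: "m dvd sigma_fps k $ (p * n)" if "odd k" for k
    using p that by (rule dvd_sigma_fps_nth_prime_mult)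
  have sigmas: "m dvd sigma_fps 1 $ (p * n)" "m dvd sigma_fps 3 $ (p * n)"
      "m dvd sigma_fps 5 $ (p * n)" "m dvd sigma_fps 7 $ (p * n)" "m dvd sigma_fps 9 $ (p * n)"
    by (intro sigma; simp)+
  have "int (N a) * MO a (p * n) = (of_nat (N a) * MO_series a) $ (p * n)"
    by (simp only: MO_def fps_of_nat[symmetric] fps_mult_left_const_nth of_nat_id)
  also have "m dvd \<dots>"
    using a unfolding insert_iff empty_iff
    by (elim disjE; simp only: N_def; simp add: MO_series_2 MO_series_3 MO_series_4 MO_series_5
        numeral_mult_fps_nth del: One_nat_def; intro dvd_add dvd_diff dvd_mult sigmas)
  finally show ?thesis .
qed

text \<open>Cancelling the exact power of \<open>l\<close> in \<open>N\<close> leaves one factor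
  \<open>l\<close>, which is coprime to the cofactor and so divides \<open>x\<close>.\<close>

lemma prime_dvd_if_power_multiplicity_dvd_mult:
  fixes l N :: nat and x :: int
  assumes "prime l" "N \<noteq> 0" and dvd: "int l ^ (multiplicity l N + 1) dvd int N * x"
  shows "int l dvd x"
proof -
  obtain M where M: "N = l ^ multiplicity l N * M" "\<not> l dvd M"
    using assms(1,2) by (metis multiplicity_decompose' not_prime_unit)
  have "int l ^ multiplicity l N * int l dvd int l ^ multiplicity l N * (int M * x)"
    \<comment> \<open>Only the factor \<open>N\<close> is rewritten; the first occurrence, inside
      \<open>multiplicity\<close>, must stay.\<close>
    using dvd by (subst (asm) (2) M(1)) (simp add: mult_ac)
  then have "int l dvd int M * x"
    using assms(1) by (simp add: prime_gt_0_nat)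
  then show ?thesis
    using assms(1) M(2) by (simp add: prime_dvd_mult_iff)
qed

lemma N_pos: "a \<in> {2, 3, 4, 5} \<Longrightarrow> N a \<noteq> 0"
  by (auto simp: N_def)

lemma multiplicity_N_eq_0:
  assumes "a \<in> {2, 3, 4, 5}" "prime l" "11 \<le> l"
  shows "multiplicity l (N a) = 0"
proof (rule not_dvd_imp_multiplicity_0)
  \<comment> \<open>Here 210 = 2 * 3 * 5 * 7, and 15 is the largest exponent that occurs, that of 2
    in \<open>N 5\<close>.\<close>
  have "N a dvd 210 ^ 15"
    using assms(1) by (auto simp: N_def)
  moreover have "\<not> l dvd 210"
  proof
    assume "l dvd 210"
    then have "l dvd 2 * 3 * 5 * 7" by simp
    then have "l dvd 2 \<or> l dvd 3 \<or> l dvd 5 \<or> l dvd 7"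
      using assms(2) by (simp only: prime_dvd_mult_iff) blast
    with assms(3) show False by (auto dest: dvd_imp_le)
  qed
  ultimately show "\<not> l dvd N a"
    using assms(2) prime_dvd_power dvd_trans by blast
qed

theorem corollary1p8:
  fixes a :: nat
  assumes "a \<in> {2, 3, 4, 5}"
  shows "(\<forall>l p :: nat. l \<in> {2, 3, 5, 7} \<longrightarrow> prime p \<longrightarrow>
            [int p = -1] (mod (int l ^ (multiplicity l (N a) + 1))) \<longrightarrow>
            (\<forall>n::nat. 0 < n \<longrightarrow> coprime n p \<longrightarrow> [MO a (p * n) = 0] (mod (int l)))) \<and>
         (\<forall>l p :: nat. 11 \<le> l \<longrightarrow> prime l \<longrightarrow> prime p \<longrightarrow>
            [int p = -1] (mod (int l)) \<longrightarrow>
            (\<forall>n::nat. 0 < n \<longrightarrow> coprime n p \<longrightarrow> [MO a (p * n) = 0] (mod (int l))))"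
proof -
  have main: "[MO a (p * n) = 0] (mod (int l))"
    if "prime l" "prime p" "[int p = -1] (mod (int l ^ (multiplicity l (N a) + 1)))"
      "0 < n" "coprime n p" for l p n :: nat
    using prime_dvd_if_power_multiplicity_dvd_mult[OF that(1) N_pos[OF assms]
        dvd_N_mult_MO_prime_mult[OF assms that(2,5,4,3)]]
    by (simp add: cong_0_iff)
  have "prime l" if "l \<in> {2, 3, 5, 7}" for l :: nat
    using that by auto
  \<comment> \<open>For \<open>l\<close> at least 11 the modulus in \<open>main\<close> is
    \<open>l\<close> itself, so both parts are instances of \<open>main\<close>.\<close>
  moreover have "int l ^ (multiplicity l (N a) + 1) = int l" if "prime l" "11 \<le> l" for l
    using multiplicity_N_eq_0[OF assms that] by simp
  ultimately show ?thesis
    using main by metis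
qed

end
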